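(* Let $k\ge 2$ be an integer and let $G$ be a connected graph of order $n+s$ and size $m+s$ in which $s$ vertices are of degree $1$ and all the other $n$ vertices are of degree $k$. Then, for any integer $r\ge 0$, $$t(L(S_r(G)))=k^{m+s-n-1}(rk+2)^{m-n+1}\,t(G).$$
   Context: Graphs are finite, have no loops, but may have parallel edges. The order of a graph is its number of vertices and its size is its number of edges. $t(G)$ is the number of spanning trees of $G$ (as edge sets). $L(G)$ is the line graph: its vertices are the edges of $G$, and two distinct edges $e,e'$ of $G$ are joined in $L(G)$ by as many edges as they have common ends (so two parallel edges of $G$ are joined by two parallel edges in $L(G)$). $S_r(G)$ is the graph obtained from $G$ by replacing each edge $e$ by a path of length $r+1$ connecting the two ends of $e$ (so $S_0(G)=G$). *)

theory Defs
  imports Complex_Main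
begin

text \<open>
  Finite undirected graphs without loops, with parallel edges: edges are objects of their own,
  and distinct edges may have the same set of two ends.
\<close>

record ('v, 'e) multigraph =
  verts :: "'v set"
  edges :: "'e set"
  ends :: "'e \<Rightarrow> 'v set"

definition wf_multigraph :: "('v, 'e) multigraph \<Rightarrow> bool" where
  "wf_multigraph G \<longleftrightarrow>
     finite (verts G) \<and> finite (edges G) \<and>
     (\<forall>e\<in>edges G. ends G e \<subseteq> verts G \<and> card (ends G e) = 2)"

definition vertex_degree :: "('v, 'e) multigraph \<Rightarrow> 'v \<Rightarrow> nat" where
  "vertex_degree G v = card {e \<in> edges G. v \<in> ends G e}"

definition is_walk :: "('v, 'e) multigraph \<Rightarrow> 'v list \<Rightarrow> 'e list \<Rightarrow> bool" where
  "is_walk G vs es \<longleftrightarrow>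
     length vs = Suc (length es) \<and> set vs \<subseteq> verts G \<and> set es \<subseteq> edges G \<and>
     (\<forall>i<length es. ends G (es ! i) = {vs ! i, vs ! Suc i})"

text \<open>The graph without vertices does not count as connected.\<close>

definition connected_graph :: "('v, 'e) multigraph \<Rightarrow> bool" where
  "connected_graph G \<longleftrightarrow>
     verts G \<noteq> {} \<and>
     (\<forall>u\<in>verts G. \<forall>v\<in>verts G. \<exists>vs es. is_walk G vs es \<and> hd vs = u \<and> last vs = v)"

text \<open>Since edges must be distinct, two parallel edges form a cycle of length 2,
  but going back and forth along one edge does not.\<close>

definition is_cycle :: "('v, 'e) multigraph \<Rightarrow> 'v list \<Rightarrow> 'e list \<Rightarrow> bool" where
  "is_cycle G vs es \<longleftrightarrow>
     is_walk G vs es \<and> es \<noteq> [] \<and> hd vs = last vs \<and> distinct (tl vs) \<and> distinct es"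

definition is_tree :: "('v, 'e) multigraph \<Rightarrow> bool" where
  "is_tree G \<longleftrightarrow> connected_graph G \<and> (\<nexists>vs es. is_cycle G vs es)"

definition spanning_trees :: "('v, 'e) multigraph \<Rightarrow> 'e set set" where
  "spanning_trees G = {F. F \<subseteq> edges G \<and> is_tree (G\<lparr>edges := F\<rparr>)}"

definition num_spanning_trees :: "('v, 'e) multigraph \<Rightarrow> nat" where
  "num_spanning_trees G = card (spanning_trees G)"

text \<open>The edge \<open>({e, e'}, v)\<close> of the line graph joins \<open>e\<close> and \<open>e'\<close> on account of their
  common end \<open>v\<close>, so that there is one such edge for each common end.\<close>

definition line_graph :: "('v, 'e) multigraph \<Rightarrow> ('e, 'e set \<times> 'v) multigraph" where
  "line_graph G =
     \<lparr>verts = edges G,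
      edges = {({e, e'}, v) | e e' v.
                 e \<in> edges G \<and> e' \<in> edges G \<and> e \<noteq> e' \<and> v \<in> ends G e \<inter> ends G e'},
      ends = fst\<rparr>"

text \<open>To lay out the path replacing an edge, its two ends are put in an arbitrary order.
  Up to isomorphism the subdivided graph does not depend on that choice.\<close>

definition end1 :: "('v, 'e) multigraph \<Rightarrow> 'e \<Rightarrow> 'v" where
  "end1 G e = (SOME v. v \<in> ends G e)"

definition end2 :: "('v, 'e) multigraph \<Rightarrow> 'e \<Rightarrow> 'v" where
  "end2 G e = (SOME v. v \<in> ends G e - {end1 G e})"

text \<open>Position \<open>i \<in> {0..r+1}\<close> on the path of length \<open>r + 1\<close> that replaces \<open>e\<close>; the
  positions \<open>1, \<dots>, r\<close> are the new vertices.\<close>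

definition path_vertex :: "nat \<Rightarrow> ('v, 'e) multigraph \<Rightarrow> 'e \<Rightarrow> nat \<Rightarrow> 'v + 'e \<times> nat" where
  "path_vertex r G e i =
     (if i = 0 then Inl (end1 G e)
      else if i = Suc r then Inl (end2 G e)
      else Inr (e, i))"

definition subdivision ::
  "nat \<Rightarrow> ('v, 'e) multigraph \<Rightarrow> ('v + 'e \<times> nat, 'e \<times> nat) multigraph" where
  "subdivision r G =
     \<lparr>verts = Inl ` verts G \<union> Inr ` (edges G \<times> {1..r}),
      edges = edges G \<times> {0..r},
      ends = (\<lambda>(e, i). {path_vertex r G e i, path_vertex r G e (Suc i)})\<rparr>"

lemma ends_eq_end1_end2:
  assumes "wf_multigraph G" "e \<in> edges G"
  shows "ends G e = {end1 G e, end2 G e}" "end1 G e \<noteq> end2 G e"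
proof -
  from assms obtain a b where ab: "ends G e = {a, b}" "a \<noteq> b"
    unfolding wf_multigraph_def by (meson card_2_iff)
  have 1: "end1 G e \<in> ends G e"
    unfolding end1_def by (rule someI[of _ a]) (simp add: ab)
  then have "\<exists>v. v \<in> ends G e - {end1 G e}"
    using ab by blast
  then have 2: "end2 G e \<in> ends G e - {end1 G e}"
    unfolding end2_def by (rule someI_ex)
  from 1 2 ab show "ends G e = {end1 G e, end2 G e}" "end1 G e \<noteq> end2 G e"
    by auto
qed

lemma wf_subdivision:
  assumes "wf_multigraph G"
  shows "wf_multigraph (subdivision r G)"
proof -
  have "end1 G e \<in> verts G" "end2 G e \<in> verts G" "end1 G e \<noteq> end2 G e" if "e \<in> edges G" for e
    using ends_eq_end1_end2[OF assms that] assms that unfolding wf_multigraph_def by auto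
  with assms show ?thesis
    by (auto simp: wf_multigraph_def subdivision_def path_vertex_def)
qed

lemma wf_line_graph:
  assumes "wf_multigraph G"
  shows "wf_multigraph (line_graph G)"
proof -
  have "edges (line_graph G) \<subseteq> Pow (edges G) \<times> verts G"
    using assms by (auto simp: wf_multigraph_def line_graph_def)
  then have "finite (edges (line_graph G))"
    using assms by (auto simp: wf_multigraph_def intro: finite_subset)
  with assms show ?thesis
    by (auto simp: wf_multigraph_def line_graph_def)
qed

end

theory Submission
  imports Defs "HOL-Combinatorics.Permutations"
begin

text \<open>
  The line graph of \<open>H\<close> is a union of cliques, one for each vertex. The star-mesh transformation
  replaces the clique of a vertex of degree \<open>d\<close> by a star with conductance \<open>d\<close> on its edges, so
  that \<open>L(H)\<close> becomes the incidence graph of \<open>H\<close> with weight \<open>d(v)\<close> on the pair \<open>(v, e)\<close>.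
  Eliminating the vertices \<open>e\<close> instead leaves \<open>H\<close> with resistance \<open>1 / d(u) + 1 / d(v)\<close> on an
  edge with ends \<open>u\<close> and \<open>v\<close>. For \<open>H = S\<^sub>r(G)\<close> these resistances are in series along the path of
  an edge of \<open>G\<close> and add up to \<open>r + 1 / d(u) + 1 / d(v)\<close>. This is \<open>(r k + 2) / k\<close> if both
  ends have degree \<open>k\<close>; the other edges are pendant and lie in every spanning tree.
  Each elimination is a Schur complement of the reduced Laplacian, and the matrix-tree theorem
  allows the root to be changed in between.
\<close>

section \<open>Determinants indexed by finite sets\<close>

text \<open>A root must survive an elimination: removing the vertices of \<open>H\<close> needs a
  root among its edges, removing the edges needs one among its vertices. The tree count mentions no
  root and so links the two reduced Laplacians. But trees are defined by walks and cycles, whereas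
  deletion and contraction work with cuts, so the two languages have to be reconciled.

  Each elimination splits off its pivots: \<open>d(v)^2\<close> at a vertex,
  \<open>d(u) + d(v)\<close> at an edge. The latter cancel against the denominators of the
  conductances \<open>d(u) d(v) / (d(u) + d(v))\<close>, and regrouping the numerators by vertices
  leaves \<open>d(v)^d(v)\<close>. Hence, for arbitrary positive degrees, the product of all
  \<open>d(v)^2\<close> times \<open>t(L(S_r(G)))\<close> is the product of all
  \<open>d(v)^d(v)\<close> times the sum over spanning trees \<open>T\<close> of the product of the
  resistances of the edges outside \<open>T\<close>. Only then do the two degrees 1 and
  \<open>k\<close> enter.

  Determinants are indexed by finite sets of any type because the graphs involved have vertices of
  different types, and deleting a vertex is then a set difference without any ordering.\<close>

definition set_det :: "'a set \<Rightarrow> ('a \<Rightarrow> 'a \<Rightarrow> real) \<Rightarrow> real" where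
  "set_det S A = (\<Sum>p | p permutes S. of_int (sign p) * (\<Prod>i\<in>S. A i (p i)))"

lemma set_det_empty [simp]: "set_det {} A = 1"
  by (simp add: set_det_def)

lemma set_det_cong:
  assumes "\<And>i j. i \<in> S \<Longrightarrow> j \<in> S \<Longrightarrow> A i j = B i j"
  shows "set_det S A = set_det S B"
  unfolding set_det_def
  by (intro sum.cong arg_cong2[where f = "(*)"] prod.cong) (auto simp: assms permutes_in_image)

lemma set_det_reindex:
  assumes "inj_on h S" "finite S"
  shows "set_det (h ` S) A = set_det S (\<lambda>i j. A (h i) (h j))"
proof -
  have bij: "bij_betw (map_permutation S h) {p. p permutes S} {p. p permutes (h ` S)}"
  proof (rule bij_betwI[where g = "map_permutation (h ` S) (inv_into S h)"])
    show "map_permutation S h \<in> {p. p permutes S} \<rightarrow> {p. p permutes (h ` S)}"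
      using assms(1) by (auto intro!: map_permutation_permutes inj_on_imp_bij_betw)
    show "map_permutation (h ` S) (inv_into S h) \<in> {p. p permutes (h ` S)} \<rightarrow> {p. p permutes S}"
      using assms(1)
      by (auto intro!: map_permutation_permutes bij_betw_inv_into inj_on_imp_bij_betw)
    show "map_permutation (h ` S) (inv_into S h) (map_permutation S h p) = p"
      if "p \<in> {p. p permutes S}" for p
      by (rule map_permutation_compose_inv)
        (use assms that in \<open>auto intro: inj_on_imp_bij_betw\<close>)
    show "map_permutation S h (map_permutation (h ` S) (inv_into S h) p) = p"
      if "p \<in> {p. p permutes (h ` S)}" for p
      by (rule map_permutation_compose_inv)
        (use assms that in \<open>auto intro: inj_on_imp_bij_betw bij_betw_inv_into simp: f_inv_into_f\<close>)
  qed
  have "set_det (h ` S) A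
      = (\<Sum>p | p permutes S. of_int (sign (map_permutation S h p)) *
          (\<Prod>i\<in>h ` S. A i (map_permutation S h p i)))"
    unfolding set_det_def by (rule sum.reindex_bij_betw[OF bij, symmetric])
  also have "\<dots> = set_det S (\<lambda>i j. A (h i) (h j))"
    unfolding set_det_def
    by (intro sum.cong refl)
      (simp add: prod.reindex assms sign_map_permutation map_permutation_apply)
  finally show ?thesis .
qed

lemma set_det_row_add:
  assumes "finite S" "c \<in> S"
  shows "set_det S (A(c := \<lambda>j. u j + t * v j)) = set_det S (A(c := u)) + t * set_det S (A(c := v))"
proof -
  have *: "(\<Prod>i\<in>S. (A(c := x)) i (p i)) = x (p c) * (\<Prod>i\<in>S - {c}. A i (p i))" for x p
    using assms by (subst prod.remove[of S c]) (auto intro!: prod.cong)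
  show ?thesis
    unfolding set_det_def * sum_distrib_left sum.distrib[symmetric]
    by (intro sum.cong) (auto simp: algebra_simps)
qed

text \<open>Composing with the transposition of \<open>a\<close> and \<open>b\<close> flips every
  sign and keeps every product, so the determinant equals its own negative.\<close>

lemma set_det_equal_rows:
  assumes "finite S" "a \<in> S" "b \<in> S" "a \<noteq> b" and eq: "\<And>j. j \<in> S \<Longrightarrow> A a j = A b j"
  shows "set_det S A = 0"
proof -
  let ?\<tau> = "transpose a b"
  have \<tau>: "?\<tau> permutes S"
    using assms by (simp add: permutes_swap_id)
  have perm: "permutation p" if "p permutes S" for p
    using that assms(1) permutation_permutes by blast
  have "set_det S A = (\<Sum>p | p permutes S. of_int (sign (p \<circ> ?\<tau>)) * (\<Prod>i\<in>S. A i ((p \<circ> ?\<tau>) i)))"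
    unfolding set_det_def
    by (rule sum.reindex_bij_witness[where i = "\<lambda>p. p \<circ> ?\<tau>" and j = "\<lambda>p. p \<circ> ?\<tau>"])
      (auto simp: comp_assoc intro: permutes_compose[OF \<tau>])
  also have "\<dots> = (\<Sum>p | p permutes S. - (of_int (sign p) * (\<Prod>i\<in>S. A i (p i))))"
  proof (intro sum.cong refl)
    fix p assume "p \<in> {p. p permutes S}"
    then have p: "p permutes S" by simp
    have "sign (p \<circ> ?\<tau>) = - sign p"
      using assms(4) by (simp add: sign_compose perm[OF p] perm[OF \<tau>] sign_swap_id)
    moreover have "(\<Prod>i\<in>S. A i ((p \<circ> ?\<tau>) i)) = (\<Prod>i\<in>S. A (?\<tau> i) (p (?\<tau> i)))"
      using p \<tau> by (intro prod.cong) (auto simp: Transposition.transpose_def permutes_in_image eq assms)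
    moreover have "\<dots> = (\<Prod>i\<in>S. A i (p i))"
      by (rule prod.permute[OF \<tau>, symmetric, unfolded comp_def])
    ultimately show "of_int (sign (p \<circ> ?\<tau>)) * (\<Prod>i\<in>S. A i ((p \<circ> ?\<tau>) i))
        = - (of_int (sign p) * (\<Prod>i\<in>S. A i (p i)))" by simp
  qed
  also have "\<dots> = - set_det S A"
    by (simp add: set_det_def sum_negf)
  finally show ?thesis by simp
qed

lemma set_det_zero_row:
  assumes "finite S" "c \<in> S" "\<And>j. j \<in> S \<Longrightarrow> A c j = 0"
  shows "set_det S A = 0"
  unfolding set_det_def using assms
  by (intro sum.neutral ballI) (auto simp: permutes_in_image intro!: bexI[of _ c])

lemma set_det_row_op:
  assumes "finite S" "c \<in> S" "d \<in> S" "c \<noteq> d"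
  shows "set_det S (A(c := \<lambda>j. u j + t * A d j)) = set_det S (A(c := u))"
  using assms set_det_equal_rows[of S c d "A(c := A d)"] by (simp add: set_det_row_add)

text \<open>Adding all other rows to row \<open>c\<close> turns that row into zero. Only row
  \<open>c\<close> changes on the way, so each added row is still a row of \<open>A\<close>.\<close>

lemma set_det_zero_column_sums:
  assumes "finite S" "S \<noteq> {}" and sums: "\<And>j. j \<in> S \<Longrightarrow> (\<Sum>i\<in>S. A i j) = 0"
  shows "set_det S A = 0"
proof -
  obtain c where c: "c \<in> S" using assms(2) by auto
  have "set_det S (A(c := \<lambda>j. A c j + (\<Sum>i\<in>T. A i j))) = set_det S A"
    if "T \<subseteq> S - {c}" for T
  proof -
    have "finite T" using that assms(1) by (auto intro: finite_subset)
    from this that show ?thesis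
    proof (induction T rule: finite_induct)
      case (insert d T)
      have "A(c := \<lambda>j. A c j + (\<Sum>i\<in>insert d T. A i j))
          = A(c := \<lambda>j. (A c j + (\<Sum>i\<in>T. A i j)) + 1 * A d j)"
        using insert by (simp add: algebra_simps)
      moreover have "set_det S (A(c := \<lambda>j. (A c j + (\<Sum>i\<in>T. A i j)) + 1 * A d j))
          = set_det S (A(c := \<lambda>j. A c j + (\<Sum>i\<in>T. A i j)))"
        using insert c assms(1) by (intro set_det_row_op) auto
      moreover note insert.IH
      ultimately show ?case
        using insert.prems by (simp only: insert_subset simp_thms)
    qed simp
  qed
  from this[of "S - {c}"] have "set_det S A = set_det S (A(c := \<lambda>j. A c j + (\<Sum>i\<in>S - {c}. A i j)))"
    by simp
  also have "\<dots> = 0"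
    using assms(1) c sums by (intro set_det_zero_row[of S c]) (auto simp: sum.remove[of S c])
  finally show ?thesis .
qed

text \<open>The permutations that fix \<open>c\<close> are those of \<open>S\<close>; all others
  must hit a zero. Stated by permutations, the condition covers a sparse column and a sparse row
  alike, without transposes.\<close>

lemma set_det_insert:
  assumes "finite S" "c \<notin> S"
    and zero: "\<And>p. p permutes insert c S \<Longrightarrow> p c \<noteq> c \<Longrightarrow> \<exists>i\<in>insert c S. A i (p i) = 0"
  shows "set_det (insert c S) A = A c c * set_det S A"
proof -
  have "set_det (insert c S) A
      = (\<Sum>p | p permutes S. of_int (sign p) * (\<Prod>i\<in>insert c S. A i (p i)))"
    unfolding set_det_def
  proof (rule sum.mono_neutral_right)
    show "finite {p. p permutes insert c S}"
      using assms by (simp add: finite_permutations)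
    show "{p. p permutes S} \<subseteq> {p. p permutes insert c S}"
      by (auto intro: permutes_subset)
    show "\<forall>p\<in>{p. p permutes insert c S} - {p. p permutes S}.
        of_int (sign p) * (\<Prod>i\<in>insert c S. A i (p i)) = 0"
    proof
      fix p assume p: "p \<in> {p. p permutes insert c S} - {p. p permutes S}"
      then have "p c \<noteq> c"
        using permutes_superset[of p "insert c S" S] by auto
      with p zero show "of_int (sign p) * (\<Prod>i\<in>insert c S. A i (p i)) = 0"
        using assms(1) by simp
    qed
  qed
  also have "\<dots> = A c c * set_det S A"
    unfolding set_det_def sum_distrib_left
    using assms(1,2) by (intro sum.cong) (auto simp: permutes_not_in)
  finally show ?thesis .
qed

lemma set_det_unit_column:
  assumes "finite S" "c \<notin> S" "\<And>i. i \<in> S \<Longrightarrow> A i c = 0"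
  shows "set_det (insert c S) A = A c c * set_det S A"
proof (rule set_det_insert[OF assms(1,2)])
  fix p assume p: "p permutes insert c S" "p c \<noteq> c"
  then obtain i where "p i = c" "i \<in> insert c S"
    by (metis insertI1 permutes_def permutes_in_image)
  with p assms(3) show "\<exists>i\<in>insert c S. A i (p i) = 0"
    by (intro bexI[of _ i]) auto
qed

lemma set_det_unit_row:
  assumes "finite S" "c \<notin> S" "\<And>j. j \<in> S \<Longrightarrow> A c j = 0"
  shows "set_det (insert c S) A = A c c * set_det S A"
proof (rule set_det_insert[OF assms(1,2)])
  fix p assume p: "p permutes insert c S" "p c \<noteq> c"
  then have "p c \<in> S"
    by (metis insertE insertI1 permutes_in_image)
  with assms(3) show "\<exists>i\<in>insert c S. A i (p i) = 0"
    by (intro bexI[of _ c]) auto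
qed

text \<open>The linear algebra behind deletion and contraction: an edge from the root set to
  \<open>x\<close> changes the reduced Laplacian only at the diagonal entry of \<open>x\<close>, and
  its coefficient is the minor with \<open>x\<close> joined to the root set.\<close>

lemma set_det_add_diagonal:
  assumes "finite S" "x \<in> S"
  shows "set_det S (\<lambda>i j. A i j + (if i = x \<and> j = x then t else 0))
       = set_det S A + t * set_det (S - {x}) A"
proof -
  let ?\<delta> = "\<lambda>j. if j = x then 1 else 0 :: real"
  have "(\<lambda>i j. A i j + (if i = x \<and> j = x then t else 0)) = A(x := \<lambda>j. A x j + t * ?\<delta> j)"
    by (auto simp: fun_eq_iff)
  then have "set_det S (\<lambda>i j. A i j + (if i = x \<and> j = x then t else 0))
      = set_det S (A(x := A x)) + t * set_det S (A(x := ?\<delta>))"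
    using set_det_row_add[OF assms] by metis
  moreover have "set_det S (A(x := ?\<delta>)) = set_det (S - {x}) (A(x := ?\<delta>))"
    using set_det_unit_row[of "S - {x}" x "A(x := ?\<delta>)"] assms by (auto simp: insert_absorb)
  moreover have "\<dots> = set_det (S - {x}) A"
    by (rule set_det_cong) auto
  ultimately show ?thesis by simp
qed

lemma set_det_eliminate:
  assumes "finite S" "c \<notin> S" and nz: "A c c \<noteq> 0"
  shows "set_det (insert c S) A = A c c * set_det S (\<lambda>i j. A i j - A i c * A c j / A c c)"
proof -
  \<comment> \<open>\<open>B T\<close> is the matrix in which the rows in \<open>T\<close> are
    already cleared in column \<open>c\<close>. Row \<open>c\<close> itself stays as it was, since
    \<open>c\<close> is not in \<open>S\<close>.\<close>
  define B where "B T i = (if i \<in> T then \<lambda>j. A i j - A i c * A c j / A c c else A i)" for T i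
  have "set_det (insert c S) (B T) = set_det (insert c S) A" if "T \<subseteq> S" for T
  proof -
    have "finite T" using that assms(1) by (auto intro: finite_subset)
    from this that show ?thesis
    proof (induction T rule: finite_induct)
      case (insert d T)
      have "B (insert d T) = (B T)(d := \<lambda>j. A d j + (- A d c / A c c) * B T c j)"
        using insert assms(2) by (auto simp: B_def fun_eq_iff)
      moreover have "(B T)(d := A d) = B T"
        using insert by (auto simp: B_def fun_eq_iff)
      moreover have "set_det (insert c S) ((B T)(d := \<lambda>j. A d j + (- A d c / A c c) * B T c j))
          = set_det (insert c S) ((B T)(d := A d))"
        using insert assms by (intro set_det_row_op) auto
      moreover note insert.IH
      ultimately show ?case
        using insert.prems by (simp only: insert_subset simp_thms)
    qed (simp add: B_def[abs_def])
  qed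
  then have "set_det (insert c S) A = set_det (insert c S) (B S)" by simp
  also have "\<dots> = A c c * set_det S (B S)"
    using assms by (subst set_det_unit_column) (auto simp: B_def)
  also have "set_det S (B S) = set_det S (\<lambda>i j. A i j - A i c * A c j / A c c)"
    by (rule set_det_cong) (auto simp: B_def)
  finally show ?thesis .
qed

text \<open>Schur complement of a diagonal block. Pivots in \<open>C\<close> do not see each other,
  so they can be removed one by one and keep their original values.\<close>

lemma set_det_diagonal_block:
  assumes "finite C" "finite S" "C \<inter> S = {}"
    and "\<And>c. c \<in> C \<Longrightarrow> A c c \<noteq> 0"
    and "\<And>c d. c \<in> C \<Longrightarrow> d \<in> C \<Longrightarrow> c \<noteq> d \<Longrightarrow> A c d = 0"
  shows "set_det (C \<union> S) A
       = (\<Prod>c\<in>C. A c c) * set_det S (\<lambda>i j. A i j - (\<Sum>c\<in>C. A i c * A c j / A c c))"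
  using assms
proof (induction C arbitrary: S rule: finite_induct)
  case (insert c C)
  \<comment> \<open>Removing the other pivots leaves row and column \<open>c\<close> untouched:
    their products contain an entry between two distinct elements of \<open>C\<close>.\<close>
  have col: "A i c - (\<Sum>d\<in>C. A i d * A d c / A d d) = A i c" for i
  proof -
    have "(\<Sum>d\<in>C. A i d * A d c / A d d) = 0"
      using insert by (intro sum.neutral) auto
    then show ?thesis by simp
  qed
  have row: "A c j - (\<Sum>d\<in>C. A c d * A d j / A d d) = A c j" for j
  proof -
    have "(\<Sum>d\<in>C. A c d * A d j / A d d) = 0"
      using insert by (intro sum.neutral) auto
    then show ?thesis by simp
  qed
  have "set_det (insert c C \<union> S) A = set_det (C \<union> insert c S) A" by simp
  also have "\<dots> = (\<Prod>c\<in>C. A c c)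
      * set_det (insert c S) (\<lambda>i j. A i j - (\<Sum>c\<in>C. A i c * A c j / A c c))" (is "_ = _ * set_det _ ?B")
    using insert by (intro insert.IH) auto
  also have "set_det (insert c S) ?B = ?B c c * set_det S (\<lambda>i j. ?B i j - ?B i c * ?B c j / ?B c c)"
    using insert col[of c] by (intro set_det_eliminate) auto
  also have "\<dots> = A c c * set_det S (\<lambda>i j. ?B i j - A i c * A c j / A c c)"
    by (simp only: col row)
  finally show ?case
    using insert by (simp add: algebra_simps)
qed simp

section \<open>The matrix-tree theorem\<close>

text \<open>Every vertex of \<open>V\<close> is reachable from \<open>Q\<close> by edges in \<open>F\<close>, expressed by cuts. In this form
  an edge joining \<open>Q\<close> to \<open>x\<close> is contracted by adding \<open>x\<close> to \<open>Q\<close>.\<close>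

definition spans :: "'v set \<Rightarrow> ('e \<Rightarrow> 'v set) \<Rightarrow> 'v set \<Rightarrow> 'e set \<Rightarrow> bool" where
  "spans V f Q F \<longleftrightarrow> (\<forall>S. Q \<subseteq> S \<and> S \<subset> V \<longrightarrow> (\<exists>e\<in>F. f e \<inter> S \<noteq> {} \<and> \<not> f e \<subseteq> S))"

lemma spans_self [simp]: "spans V f V F"
  by (auto simp: spans_def)

text \<open>A cut that leaves \<open>x\<close> outside is crossed by \<open>e\<close>; a cut that
  has \<open>x\<close> inside contains both ends of \<open>e\<close> and must be crossed by another
  edge.\<close>

lemma spans_insert:
  assumes "f e = {q, x}" "q \<in> Q" "x \<in> V" "x \<notin> Q"
  shows "spans V f Q (insert e F) \<longleftrightarrow> spans V f (insert x Q) F"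
proof
  assume L: "spans V f Q (insert e F)"
  show "spans V f (insert x Q) F"
    unfolding spans_def
  proof (intro allI impI)
    fix S assume S: "insert x Q \<subseteq> S \<and> S \<subset> V"
    with L obtain g where "g \<in> insert e F" "f g \<inter> S \<noteq> {}" "\<not> f g \<subseteq> S"
      unfolding spans_def by (meson insert_subset)
    with S assms show "\<exists>e\<in>F. f e \<inter> S \<noteq> {} \<and> \<not> f e \<subseteq> S" by auto
  qed
next
  assume R: "spans V f (insert x Q) F"
  show "spans V f Q (insert e F)"
    unfolding spans_def
  proof (intro allI impI)
    fix S assume S: "Q \<subseteq> S \<and> S \<subset> V"
    show "\<exists>e\<in>insert e F. f e \<inter> S \<noteq> {} \<and> \<not> f e \<subseteq> S"
    proof (cases "x \<in> S")
      case True
      with R S show ?thesis unfolding spans_def by (meson insertI2 insert_subset)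
    next
      case False
      with S assms show ?thesis by (intro bexI[of _ e]) auto
    qed
  qed
qed

lemma crossing_edge_ends:
  assumes "card X = 2" "X \<inter> S \<noteq> {}" "\<not> X \<subseteq> S"
  obtains q x where "X = {q, x}" "q \<in> S" "x \<notin> S"
  using assms by (auto simp: card_2_iff)

definition edge_laplacian :: "'v set \<Rightarrow> 'v \<Rightarrow> 'v \<Rightarrow> real" where
  "edge_laplacian X i j = (if i \<in> X \<and> j \<in> X then if i = j then 1 else - 1 else 0)"

lemma edge_laplacian_column_sum:
  assumes "finite V" "X \<subseteq> V" "card X = 2"
  shows "(\<Sum>i\<in>V. edge_laplacian X i j) = 0"
proof -
  have "(\<Sum>i\<in>V. edge_laplacian X i j) = (\<Sum>i\<in>X. edge_laplacian X i j)"
    using assms by (intro sum.mono_neutral_right) (auto simp: edge_laplacian_def)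
  also have "\<dots> = 0"
    using assms(3) by (auto simp: card_2_iff edge_laplacian_def)
  finally show ?thesis .
qed

text \<open>Deletion and contraction of \<open>e\<close>. Forests are singled out by their number of
  edges instead of by acyclicity, because this number drops by one exactly when \<open>x\<close>
  joins the root set.\<close>

lemma spanning_forests_insert_root:
  assumes "finite V" "finite E" "Q \<subseteq> V" "e \<in> E" and e: "f e = {q, x}" "q \<in> Q" "x \<in> V - Q"
  shows "{F. F \<subseteq> E \<and> spans V f Q F \<and> card F = card (V - Q)}
    = {F. F \<subseteq> E - {e} \<and> spans V f Q F \<and> card F = card (V - Q)}
      \<union> insert e ` {F. F \<subseteq> E - {e} \<and> spans V f (insert x Q) F \<and> card F = card (V - insert x Q)}"
    (is "?L = ?A \<union> insert e ` ?B")
proof -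
  have "V - Q = insert x (V - insert x Q)"
    using e by auto
  then have card: "card (V - Q) = Suc (card (V - insert x Q))"
    using assms(1) by (metis Diff_iff card_insert_disjoint finite_Diff insertI1)
  have ins: "spans V f Q (insert e F) \<longleftrightarrow> spans V f (insert x Q) F" for F
    by (rule spans_insert) (use e in auto)
  have fin: "finite F" if "F \<subseteq> E - {e}" for F
    using that assms(2) by (auto intro: finite_subset)
  show ?thesis
  proof (intro equalityI subsetI)
    fix F assume F: "F \<in> ?L"
    show "F \<in> ?A \<union> insert e ` ?B"
    proof (cases "e \<in> F")
      case True
      have "finite F"
        using F assms(2) by (auto intro: finite_subset)
      then have "F - {e} \<in> ?B"
        using F True ins[of "F - {e}"] card by (auto simp: insert_absorb)
      moreover have "F = insert e (F - {e})"
        using True by auto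
      ultimately show ?thesis by blast
    qed (use F in auto)
  next
    fix F assume "F \<in> ?A \<union> insert e ` ?B"
    then show "F \<in> ?L"
    proof
      assume "F \<in> insert e ` ?B"
      then obtain F' where F': "F = insert e F'" "F' \<in> ?B" by auto
      then have "card F = Suc (card F')"
        using fin[of F'] by (subst F'(1), subst card_insert_disjoint) auto
      with F' show ?thesis
        using assms(4) card ins[of F'] by auto
    qed auto
  qed
qed

text \<open>Both sides obey the same deletion-contraction recursion as long as some edge leaves
  \<open>Q\<close>. Admitting root sets instead of a single root keeps \<open>V\<close> and
  \<open>f\<close> fixed, since contraction only enlarges \<open>Q\<close>.\<close>

theorem set_det_spanning_forests:
  assumes "finite V" "finite E" "\<And>e. e \<in> E \<Longrightarrow> f e \<subseteq> V \<and> card (f e) = 2" "Q \<subseteq> V"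
  shows "set_det (V - Q) (\<lambda>i j. \<Sum>e\<in>E. w e * edge_laplacian (f e) i j)
       = (\<Sum>F | F \<subseteq> E \<and> spans V f Q F \<and> card F = card (V - Q). \<Prod>e\<in>F. w e)"
  using assms(2,3,4)
proof (induction E arbitrary: Q rule: finite_psubset_induct)
  case (psubset E)
  let ?A = "\<lambda>E i j. \<Sum>e\<in>E. w e * edge_laplacian (f e) i j"
  show ?case
  proof (cases "\<exists>e\<in>E. f e \<inter> Q \<noteq> {} \<and> \<not> f e \<subseteq> Q")
    case True
    then obtain e q x where e: "e \<in> E" "f e = {q, x}" "q \<in> Q" "x \<notin> Q"
      using psubset.prems(1) by (meson crossing_edge_ends)
    then have x: "x \<in> V - Q" using psubset.prems(1)[of e] by auto
    have sub: "E - {e} \<subset> E" using e by auto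
    \<comment> \<open>As \<open>q\<close> lies in \<open>Q\<close>, the edge \<open>e\<close> is
      visible on \<open>V - Q\<close> only at the entry of \<open>x\<close> with itself.\<close>
    have "set_det (V - Q) (?A E)
        = set_det (V - Q) (\<lambda>i j. ?A (E - {e}) i j + (if i = x \<and> j = x then w e else 0))"
      using e psubset.hyps
      by (intro set_det_cong) (auto simp: sum.remove[of E e] edge_laplacian_def)
    also have "\<dots> = set_det (V - Q) (?A (E - {e})) + w e * set_det (V - Q - {x}) (?A (E - {e}))"
      using assms(1) x by (intro set_det_add_diagonal) auto
    also have "V - Q - {x} = V - insert x Q" by auto
    also have "set_det (V - Q) (?A (E - {e}))
        = (\<Sum>F | F \<subseteq> E - {e} \<and> spans V f Q F \<and> card F = card (V - Q). \<Prod>e\<in>F. w e)"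
      (is "_ = sum _ ?\<A>")
      using psubset.prems by (intro psubset.IH[OF sub]) auto
    also have "set_det (V - insert x Q) (?A (E - {e}))
        = (\<Sum>F | F \<subseteq> E - {e} \<and> spans V f (insert x Q) F \<and> card F = card (V - insert x Q). \<Prod>e\<in>F. w e)"
      (is "_ = sum _ ?\<B>")
      using psubset.prems x by (intro psubset.IH[OF sub]) auto
    also have "w e * (\<Sum>F\<in>?\<B>. \<Prod>e\<in>F. w e) = (\<Sum>F\<in>insert e ` ?\<B>. \<Prod>e\<in>F. w e)"
    proof -
      have "inj_on (insert e) ?\<B>" by (auto simp: inj_on_def)
      moreover have "(\<Prod>e\<in>insert e F. w e) = w e * (\<Prod>e\<in>F. w e)" if "F \<in> ?\<B>" for F
        using that psubset.hyps by (intro prod.insert) (auto intro: finite_subset)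
      ultimately show ?thesis by (simp add: sum.reindex sum_distrib_left)
    qed
    also have "(\<Sum>F\<in>?\<A>. \<Prod>e\<in>F. w e) + \<dots> = (\<Sum>F\<in>?\<A> \<union> insert e ` ?\<B>. \<Prod>e\<in>F. w e)"
    proof (rule sum.union_disjoint[symmetric])
      have "finite (Pow (E - {e}))" using psubset.hyps by auto
      then show "finite ?\<A>" "finite (insert e ` ?\<B>)"
        by (auto intro: finite_subset[rotated])
      show "?\<A> \<inter> insert e ` ?\<B> = {}" by auto
    qed
    also have "?\<A> \<union> insert e ` ?\<B> = {F. F \<subseteq> E \<and> spans V f Q F \<and> card F = card (V - Q)}"
      using spanning_forests_insert_root[where f = f, OF assms(1) psubset.hyps psubset.prems(2) e(1,2,3) x]
      by simp
    finally show ?thesis .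
  next
    case no: False
    show ?thesis
    proof (cases "Q = V")
      \<comment> \<open>Both sides are 1: an empty determinant, and the empty forest as the only
        one.\<close>
      case True
      have "F = {}" if "F \<subseteq> E" "card F = 0" for F
        using that psubset.hyps by (metis card_0_eq finite_subset)
      then have "{F. F \<subseteq> E \<and> spans V f Q F \<and> card F = card (V - Q)} = {{}}"
        using True by auto
      then show ?thesis using True by simp
    next
      case False
      have "\<not> spans V f Q F" if "F \<subseteq> E" for F
      proof
        assume "spans V f Q F"
        moreover have "Q \<subset> V" using False psubset.prems(2) by auto
        ultimately show False using no that unfolding spans_def by blast
      qed
      then have none: "{F. F \<subseteq> E \<and> spans V f Q F \<and> card F = card (V - Q)} = {}"
        by auto
      \<comment> \<open>No edge leaves \<open>Q\<close>, so each edge lies inside \<open>Q\<close>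
        or inside \<open>V - Q\<close>. The reduced matrix is then the full Laplacian of the rest
        and its columns sum to zero.\<close>
      have "set_det (V - Q) (?A E) = 0"
      proof (rule set_det_zero_column_sums)
        fix j assume j: "j \<in> V - Q"
        have "(\<Sum>i\<in>V - Q. ?A E i j) = (\<Sum>e\<in>E. \<Sum>i\<in>V - Q. w e * edge_laplacian (f e) i j)"
          by (rule sum.swap)
        also have "\<dots> = 0"
        proof (rule sum.neutral, rule ballI)
          fix e assume e: "e \<in> E"
          have "(\<Sum>i\<in>V - Q. edge_laplacian (f e) i j) = 0"
          proof (cases "f e \<subseteq> Q")
            case True
            with j show ?thesis by (intro sum.neutral) (auto simp: edge_laplacian_def)
          next
            case False
            with no e have "f e \<subseteq> V - Q" using psubset.prems(1)[OF e] by auto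
            then show ?thesis
              using edge_laplacian_column_sum[of "V - Q" "f e" j] assms(1) psubset.prems(1)[OF e]
              by auto
          qed
          then show "(\<Sum>i\<in>V - Q. w e * edge_laplacian (f e) i j) = 0"
            by (simp add: sum_distrib_left[symmetric])
        qed
        finally show "(\<Sum>i\<in>V - Q. ?A E i j) = 0" .
      qed (use assms(1) False psubset.prems(2) in auto)
      then show ?thesis by (simp only: none sum.empty)
    qed
  qed
qed

section \<open>Cuts, walks, cycles and spanning trees\<close>

text \<open>Greedy growth: as long as \<open>Q\<close> is not everything, some edge leaves it, and
  absorbing the outer end uses one edge per new vertex.\<close>

lemma spans_imp_spanning_forest:
  assumes "finite F" "spans V f Q F" "\<And>e. e \<in> F \<Longrightarrow> f e \<subseteq> V \<and> card (f e) = 2"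
    "finite V" "Q \<subseteq> V"
  shows "\<exists>F'\<subseteq>F. spans V f Q F' \<and> card F' = card (V - Q)"
  using assms
proof (induction F arbitrary: Q rule: finite_psubset_induct)
  case (psubset F)
  show ?case
  proof (cases "Q = V")
    case True
    then show ?thesis by (intro exI[of _ "{}"]) auto
  next
    case False
    then obtain e q x where e: "e \<in> F" "f e = {q, x}" "q \<in> Q" "x \<notin> Q"
      using psubset.prems(1,2,4) unfolding spans_def
      by (metis crossing_edge_ends psubsetI subset_refl)
    have x: "x \<in> V - Q" using e psubset.prems(2)[of e] by auto
    have "spans V f Q (insert e (F - {e}))"
      using e psubset.prems by (simp add: insert_absorb)
    then have "spans V f (insert x Q) (F - {e})"
      using spans_insert[of f e q x Q V "F - {e}"] e x by auto
    then obtain F' where F': "F' \<subseteq> F - {e}" "spans V f (insert x Q) F'" "card F' = card (V - insert x Q)"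
      using psubset.IH[of "F - {e}" "insert x Q"] psubset.prems e x by auto
    have "insert e F' \<in> {F'. F' \<subseteq> F \<and> spans V f Q F' \<and> card F' = card (V - Q)}"
      by (subst spanning_forests_insert_root[where e = e and q = q and x = x])
        (use psubset.prems psubset.hyps e x F' in auto)
    then show ?thesis by blast
  qed
qed

text \<open>A set and its complement are crossed by the same edges, and one of the two contains
  \<open>q\<close>.\<close>

lemma spans_change_root:
  assumes "spans V f {q} F" "a \<in> V" "q \<in> V" "\<And>e. e \<in> F \<Longrightarrow> f e \<subseteq> V"
  shows "spans V f {a} F"
  unfolding spans_def
proof (intro allI impI)
  fix S assume S: "{a} \<subseteq> S \<and> S \<subset> V"
  show "\<exists>e\<in>F. f e \<inter> S \<noteq> {} \<and> \<not> f e \<subseteq> S"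
  proof (cases "q \<in> S")
    case True
    with S assms show ?thesis unfolding spans_def by auto
  next
    case False
    with assms S have "{q} \<subseteq> V - S \<and> V - S \<subset> V" by auto
    with assms(1) obtain e where "e \<in> F" "f e \<inter> (V - S) \<noteq> {}" "\<not> f e \<subseteq> V - S"
      unfolding spans_def by meson
    with assms(4) show ?thesis by (intro bexI[of _ e]) auto
  qed
qed

lemma walk_crosses:
  assumes "is_walk G vs es" "hd vs \<in> S" "last vs \<notin> S"
  shows "\<exists>e\<in>set es. ends G e \<inter> S \<noteq> {} \<and> \<not> ends G e \<subseteq> S"
proof (rule ccontr)
  assume no: "\<not> ?thesis"
  have len: "length vs = Suc (length es)"
    and step: "\<And>i. i < length es \<Longrightarrow> ends G (es ! i) = {vs ! i, vs ! Suc i}"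
    using assms(1) by (auto simp: is_walk_def)
  have "i \<le> length es \<Longrightarrow> vs ! i \<in> S" for i
  proof (induction i)
    case 0
    with assms(2) len show ?case by (cases vs) auto
  next
    case (Suc i)
    then have "es ! i \<in> set es" "vs ! i \<in> S" by auto
    with no step[of i] Suc.prems show ?case by force
  qed
  from this[of "length es"] assms(3) len show False
    by (metis diff_Suc_1 last_conv_nth le_refl length_0_conv nat.distinct(1))
qed

text \<open>The vertices reached by paths form a set that no edge of \<open>F\<close> leaves.
  Distinct vertices are demanded so that an additional edge can close the path to a cycle.\<close>

lemma spans_imp_path:
  assumes wf: "wf_multigraph G" and F: "F \<subseteq> edges G" "spans (verts G) (ends G) {a} F"
    and v: "a \<in> verts G" "v \<in> verts G"
  shows "\<exists>vs es. is_walk G vs es \<and> set es \<subseteq> F \<and> hd vs = a \<and> last vs = v \<and> distinct vs"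
proof -
  define P where "P v vs es \<longleftrightarrow>
    is_walk G vs es \<and> set es \<subseteq> F \<and> hd vs = a \<and> last vs = v \<and> distinct vs" for v vs es
  define S where "S = {v \<in> verts G. \<exists>vs es. P v vs es}"
  have "P a [a] []"
    using v by (auto simp: P_def is_walk_def)
  then have "a \<in> S" using v by (auto simp: S_def)
  have "S = verts G"
  proof (rule ccontr)
    assume "S \<noteq> verts G"
    then have "{a} \<subseteq> S \<and> S \<subset> verts G"
      using \<open>a \<in> S\<close> by (auto simp: S_def)
    with F(2) obtain e where e: "e \<in> F" "ends G e \<inter> S \<noteq> {}" "\<not> ends G e \<subseteq> S"
      unfolding spans_def by meson
    with F(1) wf have "card (ends G e) = 2" "ends G e \<subseteq> verts G"
      by (auto simp: wf_multigraph_def)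
    with e obtain x y where xy: "ends G e = {x, y}" "x \<in> S" "y \<notin> S" "y \<in> verts G"
      by (metis crossing_edge_ends insert_subset)
    then obtain vs es where p: "P x vs es" by (auto simp: S_def)
    then have vs: "length vs = Suc (length es)" "vs \<noteq> []" "distinct vs" "hd vs = a" "last vs = x"
      and es: "set es \<subseteq> F"
      and step: "\<And>i. i < length es \<Longrightarrow> ends G (es ! i) = {vs ! i, vs ! Suc i}"
      and sub: "set vs \<subseteq> verts G" "set es \<subseteq> edges G"
      by (auto simp: P_def is_walk_def)
    have "\<exists>vs es. P y vs es"
    \<comment> \<open>If the path already visits \<open>y\<close>, its initial segment up to
      \<open>y\<close> is taken; otherwise the crossing edge extends it.\<close>
    proof (cases "y \<in> set vs")
      case True
      then obtain i where i: "i < length vs" "vs ! i = y" by (auto simp: in_set_conv_nth)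
      have "P y (take (Suc i) vs) (take i es)"
        unfolding P_def is_walk_def
      proof (intro conjI allI impI)
        show "length (take (Suc i) vs) = Suc (length (take i es))" using i vs by auto
        show "set (take (Suc i) vs) \<subseteq> verts G" "set (take i es) \<subseteq> edges G" "set (take i es) \<subseteq> F"
          using sub es by (meson set_take_subset subset_trans)+
        show "ends G (take i es ! j) = {take (Suc i) vs ! j, take (Suc i) vs ! Suc j}"
          if "j < length (take i es)" for j
          using that step[of j] by auto
        show "hd (take (Suc i) vs) = a" using vs by simp
        show "last (take (Suc i) vs) = y" using i by (simp add: take_Suc_conv_app_nth)
        show "distinct (take (Suc i) vs)" using vs by simp
      qed
      then show ?thesis by blast
    next
      case False
      have "P y (vs @ [y]) (es @ [e])"
        unfolding P_def is_walk_def
      proof (intro conjI allI impI)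
        show "length (vs @ [y]) = Suc (length (es @ [e]))" using vs by auto
        show "set (vs @ [y]) \<subseteq> verts G" "set (es @ [e]) \<subseteq> edges G" "set (es @ [e]) \<subseteq> F"
          using sub es e xy F(1) by auto
        show "ends G ((es @ [e]) ! j) = {(vs @ [y]) ! j, (vs @ [y]) ! Suc j}"
          if "j < length (es @ [e])" for j
        proof (cases "j < length es")
          case True
          with step[of j] vs show ?thesis by (auto simp: nth_append)
        next
          case False
          with that have "j = length es" by auto
          moreover have "vs ! length es = x"
            using vs by (metis diff_Suc_1 last_conv_nth)
          ultimately show ?thesis using vs xy by (auto simp: nth_append)
        qed
        show "hd (vs @ [y]) = a" using vs by simp
        show "last (vs @ [y]) = y" by simp
        show "distinct (vs @ [y])" using vs False by simp
      qed
      then show ?thesis by blast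
    qed
    with xy show False by (auto simp: S_def)
  qed
  with v show ?thesis by (auto simp: S_def P_def)
qed

lemma connected_graph_iff_spans:
  assumes "wf_multigraph G" "q \<in> verts G"
  shows "connected_graph G \<longleftrightarrow> spans (verts G) (ends G) {q} (edges G)"
proof
  assume con: "connected_graph G"
  show "spans (verts G) (ends G) {q} (edges G)"
    unfolding spans_def
  proof (intro allI impI)
    fix S assume S: "{q} \<subseteq> S \<and> S \<subset> verts G"
    then obtain v where v: "v \<in> verts G" "v \<notin> S" by auto
    with con assms(2) obtain vs es where w: "is_walk G vs es" "hd vs = q" "last vs = v"
      unfolding connected_graph_def by blast
    then obtain e where "e \<in> set es" "ends G e \<inter> S \<noteq> {}" "\<not> ends G e \<subseteq> S"
      using walk_crosses[of G vs es S] S v by auto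
    then show "\<exists>e\<in>edges G. ends G e \<inter> S \<noteq> {} \<and> \<not> ends G e \<subseteq> S"
      using w by (auto simp: is_walk_def)
  qed
next
  assume sp: "spans (verts G) (ends G) {q} (edges G)"
  have "spans (verts G) (ends G) {u} (edges G)" if "u \<in> verts G" for u
    using spans_change_root[OF sp that assms(2)] assms(1) by (auto simp: wf_multigraph_def)
  then show "connected_graph G"
    unfolding connected_graph_def
    using assms spans_imp_path[OF assms(1) order_refl] by blast
qed

lemma path_edges_distinct:
  assumes "is_walk G vs es" "distinct vs"
  shows "distinct es"
  unfolding distinct_conv_nth
proof (intro allI impI)
  fix i j assume ij: "i < length es" "j < length es" "i \<noteq> j"
  have len: "length vs = Suc (length es)"
    and step: "\<And>i. i < length es \<Longrightarrow> ends G (es ! i) = {vs ! i, vs ! Suc i}"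
    using assms(1) by (auto simp: is_walk_def)
  show "es ! i \<noteq> es ! j"
  proof
    assume "es ! i = es ! j"
    then have "{vs ! i, vs ! Suc i} = {vs ! j, vs ! Suc j}"
      using step ij by metis
    with ij len assms(2) show False
      by (auto simp: doubleton_eq_iff nth_eq_iff_index_eq)
  qed
qed

text \<open>The rest of the cycle joins the two ends of its first edge, so it crosses every cut that
  this edge crosses.\<close>

lemma cycle_edge_redundant:
  assumes "is_cycle G vs es" "spans (verts G) (ends G) {q} (edges G)"
  shows "spans (verts G) (ends G) {q} (edges G - {hd es})"
  unfolding spans_def
proof (intro allI impI)
  fix S assume S: "{q} \<subseteq> S \<and> S \<subset> verts G"
  from assms(1) have cyc: "is_walk G vs es" "es \<noteq> []" "hd vs = last vs" "distinct es"
    by (auto simp: is_cycle_def)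
  then obtain e es' v v' vs' where eq: "es = e # es'" "vs = v # v' # vs'"
    by (cases es; cases vs; cases "tl vs") (auto simp: is_walk_def)
  have rest: "is_walk G (v' # vs') es'" "ends G e = {v, v'}"
    using cyc(1) unfolding eq is_walk_def by force+
  from assms(2) S obtain g where g: "g \<in> edges G" "ends G g \<inter> S \<noteq> {}" "\<not> ends G g \<subseteq> S"
    unfolding spans_def by meson
  show "\<exists>e\<in>edges G - {hd es}. ends G e \<inter> S \<noteq> {} \<and> \<not> ends G e \<subseteq> S"
  proof (cases "g = e")
    case False
    with g eq show ?thesis by auto
  next
    case True
    have last: "last (v' # vs') = v" using cyc(3) eq by simp
    have "\<exists>h\<in>set es'. ends G h \<inter> S \<noteq> {} \<and> \<not> ends G h \<subseteq> S"
    proof (cases "v' \<in> S")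
      case True
      then show ?thesis
        using walk_crosses[OF rest(1), of S] last g \<open>g = e\<close> rest(2) by auto
    next
      case False
      \<comment> \<open>If \<open>v'\<close> is outside \<open>S\<close>, the remaining walk starts
        in the complement and ends in \<open>S\<close>; crossing the complement is the same as
        crossing \<open>S\<close>.\<close>
      then obtain h where "h \<in> set es'" "ends G h \<inter> - S \<noteq> {}" "\<not> ends G h \<subseteq> - S"
        using walk_crosses[OF rest(1), of "- S"] last g \<open>g = e\<close> rest(2) by auto
      then show ?thesis by (intro bexI[of _ h]) auto
    qed
    moreover have "set es' \<subseteq> edges G - {hd es}"
      using cyc eq by (auto simp: is_walk_def)
    ultimately show ?thesis by blast
  qed
qed

text \<open>An edge outside a spanning set of \<open>card (verts G - {q})\<close> edges would close
  a cycle. Conversely, a cycle edge could be dropped while still spanning, which would leave fewer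
  edges than a spanning set needs.\<close>

lemma is_tree_iff:
  assumes wf: "wf_multigraph G" and q: "q \<in> verts G"
  shows "is_tree G \<longleftrightarrow>
    spans (verts G) (ends G) {q} (edges G) \<and> card (edges G) = card (verts G - {q})"
proof -
  let ?sp = "spans (verts G) (ends G) {q}"
  have fin: "finite (edges G)" "finite (verts G)"
    and ends: "\<And>e. e \<in> edges G \<Longrightarrow> ends G e \<subseteq> verts G \<and> card (ends G e) = 2"
    using wf by (auto simp: wf_multigraph_def)
  have forest: "\<exists>F'\<subseteq>F. ?sp F' \<and> card F' = card (verts G - {q})" if "?sp F" "F \<subseteq> edges G" for F
    using that fin ends q by (intro spans_imp_spanning_forest) (auto intro: finite_subset)
  have "(\<nexists>vs es. is_cycle G vs es) \<longleftrightarrow> card (edges G) = card (verts G - {q})" if sp: "?sp (edges G)"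
  proof
    assume acyclic: "\<nexists>vs es. is_cycle G vs es"
    obtain F where F: "F \<subseteq> edges G" "?sp F" "card F = card (verts G - {q})"
      using forest[OF sp] by auto
    have "F = edges G"
    proof (rule ccontr)
      assume "F \<noteq> edges G"
      with F obtain e where e: "e \<in> edges G" "e \<notin> F" by auto
      then obtain a b where ab: "ends G e = {a, b}" "a \<in> verts G" "b \<in> verts G"
        using ends[OF e(1)] by (auto simp: card_2_iff)
      have "spans (verts G) (ends G) {a} F"
        using spans_change_root[OF F(2) ab(2) q] F(1) ends by blast
      then obtain vs es where p: "is_walk G vs es" "set es \<subseteq> F" "hd vs = a" "last vs = b" "distinct vs"
        using spans_imp_path[OF wf F(1) _ ab(2,3)] by blast
      then have p': "length vs = Suc (length es)" "vs \<noteq> []" "set vs \<subseteq> verts G" "set es \<subseteq> edges G"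
        and step: "\<And>i. i < length es \<Longrightarrow> ends G (es ! i) = {vs ! i, vs ! Suc i}"
        by (auto simp: is_walk_def)
      \<comment> \<open>Dropping the first \<open>a\<close> and appending it again only rotates
        \<open>vs\<close>, hence the tail is distinct. The edge \<open>e\<close> is new because the
        path stays in \<open>F\<close>.\<close>
      have "is_cycle G (vs @ [a]) (es @ [e])"
        unfolding is_cycle_def is_walk_def
      proof (intro conjI allI impI)
        show "length (vs @ [a]) = Suc (length (es @ [e]))" using p' by auto
        show "set (vs @ [a]) \<subseteq> verts G" "set (es @ [e]) \<subseteq> edges G"
          using p' e ab by auto
        show "ends G ((es @ [e]) ! j) = {(vs @ [a]) ! j, (vs @ [a]) ! Suc j}"
          if "j < length (es @ [e])" for j
        proof (cases "j < length es")
          case True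
          with step[of j] p' show ?thesis by (auto simp: nth_append)
        next
          case False
          with that have "j = length es" by auto
          moreover have "vs ! length es = b"
            using p p' by (metis diff_Suc_1 last_conv_nth)
          ultimately show ?thesis using p' ab by (auto simp: nth_append)
        qed
        show "es @ [e] \<noteq> []" by simp
        show "hd (vs @ [a]) = last (vs @ [a])" using p p' by simp
        show "distinct (tl (vs @ [a]))"
          using p p' by (cases vs) auto
        show "distinct (es @ [e])"
          using path_edges_distinct[OF p(1,5)] p(2) e by auto
      qed
      with acyclic show False by blast
    qed
    with F show "card (edges G) = card (verts G - {q})" by simp
  next
    assume card: "card (edges G) = card (verts G - {q})"
    show "\<nexists>vs es. is_cycle G vs es"
    proof
      assume "\<exists>vs es. is_cycle G vs es"
      then obtain vs es where c: "is_cycle G vs es" by blast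
      then have "hd es \<in> edges G"
        by (cases es) (auto simp: is_cycle_def is_walk_def)
      moreover obtain F where "F \<subseteq> edges G - {hd es}" "card F = card (verts G - {q})"
        using forest[OF cycle_edge_redundant[OF c sp]] by auto
      then have "card (verts G - {q}) \<le> card (edges G - {hd es})"
        using fin by (metis card_mono finite_Diff)
      ultimately show False
        using card fin by (metis card_Diff1_less leD)
    qed
  qed
  then show ?thesis
    unfolding is_tree_def connected_graph_iff_spans[OF wf q] by blast
qed

lemma spanning_trees_eq:
  assumes "wf_multigraph G" "q \<in> verts G"
  shows "spanning_trees G = {F. F \<subseteq> edges G \<and> spans (verts G) (ends G) {q} F \<and>
    card F = card (verts G - {q})}"
proof -
  have "is_tree (G\<lparr>edges := F\<rparr>) \<longleftrightarrow>
      spans (verts G) (ends G) {q} F \<and> card F = card (verts G - {q})" if "F \<subseteq> edges G" for F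
  proof -
    have "wf_multigraph (G\<lparr>edges := F\<rparr>)"
      using assms(1) that by (auto simp: wf_multigraph_def intro: finite_subset)
    from is_tree_iff[OF this, of q] assms(2) show ?thesis by simp
  qed
  then show ?thesis by (auto simp: spanning_trees_def)
qed

section \<open>Weighted tree counts as reduced determinants\<close>

text \<open>The Kirchhoff polynomial in the form that multiplies the weights of tree edges, so
  weights are conductances rather than resistances.\<close>

definition tree_poly :: "('v, 'e) multigraph \<Rightarrow> ('e \<Rightarrow> real) \<Rightarrow> real" where
  "tree_poly G w = (\<Sum>T\<in>spanning_trees G. \<Prod>e\<in>T. w e)"

definition laplacian :: "('v, 'e) multigraph \<Rightarrow> ('e \<Rightarrow> real) \<Rightarrow> 'v \<Rightarrow> 'v \<Rightarrow> real" where
  "laplacian G w i j = (\<Sum>e\<in>edges G. w e * edge_laplacian (ends G e) i j)"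

text \<open>The root \<open>q\<close> occurs only on the right, so all roots give the same
  determinant.\<close>

theorem matrix_tree:
  assumes "wf_multigraph G" "q \<in> verts G"
  shows "tree_poly G w = set_det (verts G - {q}) (laplacian G w)"
  using assms unfolding tree_poly_def spanning_trees_eq[OF assms] laplacian_def[abs_def]
  by (subst set_det_spanning_forests) (auto simp: wf_multigraph_def)

section \<open>Star-mesh transformation\<close>

text \<open>Parallel edges enter the Laplacian only through their total. Stated for pairs of
  vertices, the electrical identities need no correspondence between the edges of two
  graphs.\<close>

definition conductance :: "('v, 'e) multigraph \<Rightarrow> ('e \<Rightarrow> real) \<Rightarrow> 'v set \<Rightarrow> real" where
  "conductance G w X = (\<Sum>e | e \<in> edges G \<and> ends G e = X. w e)"

lemma laplacian_offdiag:
  assumes "wf_multigraph G" "i \<noteq> j"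
  shows "laplacian G w i j = - conductance G w {i, j}"
proof -
  have "w e * edge_laplacian (ends G e) i j = (if ends G e = {i, j} then - w e else 0)"
    if "e \<in> edges G" for e
  proof -
    have "card (ends G e) = 2"
      using that assms(1) by (auto simp: wf_multigraph_def)
    then show ?thesis
      using assms(2) by (auto simp: edge_laplacian_def card_2_iff)
  qed
  then have "laplacian G w i j = (\<Sum>e\<in>edges G. if ends G e = {i, j} then - w e else 0)"
    unfolding laplacian_def by (rule sum.cong[OF refl])
  also have "\<dots> = (\<Sum>e | e \<in> edges G \<and> ends G e = {i, j}. - w e)"
    using assms(1) by (subst sum.inter_filter) (auto simp: wf_multigraph_def)
  finally show ?thesis by (simp add: conductance_def sum_negf)
qed

lemma laplacian_diag:
  assumes "wf_multigraph G" "i \<in> verts G"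
  shows "laplacian G w i i = (\<Sum>k\<in>verts G - {i}. conductance G w {i, k})"
proof -
  have "(\<Sum>k\<in>verts G. laplacian G w k i)
      = (\<Sum>e\<in>edges G. w e * (\<Sum>k\<in>verts G. edge_laplacian (ends G e) k i))"
    unfolding laplacian_def sum_distrib_left by (rule sum.swap)
  also have "\<dots> = 0"
    using assms(1) by (intro sum.neutral ballI) (auto simp: edge_laplacian_column_sum wf_multigraph_def)
  finally have "laplacian G w i i = - (\<Sum>k\<in>verts G - {i}. laplacian G w k i)"
    using assms by (simp add: sum.remove wf_multigraph_def add_eq_0_iff)
  also have "\<dots> = (\<Sum>k\<in>verts G - {i}. conductance G w {i, k})"
    using assms(1) by (simp add: laplacian_offdiag insert_commute sum_negf)
  finally show ?thesis .
qed

text \<open>Gaussian elimination of the pairwise non-adjacent vertices \<open>C\<close> is a Schur complement of the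
  Laplacian, and that Schur complement is again a Laplacian.\<close>

theorem star_mesh:
  assumes wf: "wf_multigraph G" "wf_multigraph G'" and ne: "verts G' \<noteq> {}"
    and h: "inj_on h (verts G')" "verts G = C \<union> h ` verts G'" "C \<inter> h ` verts G' = {}"
    and indep: "\<And>c d. c \<in> C \<Longrightarrow> d \<in> C \<Longrightarrow> c \<noteq> d \<Longrightarrow> conductance G w {c, d} = 0"
    and S: "\<And>c. c \<in> C \<Longrightarrow> (\<Sum>x\<in>verts G'. conductance G w {c, h x}) = S c"
    and nz: "\<And>c. c \<in> C \<Longrightarrow> S c \<noteq> 0"
    and mesh: "\<And>i j. i \<in> verts G' \<Longrightarrow> j \<in> verts G' \<Longrightarrow> i \<noteq> j \<Longrightarrow>
      conductance G' w' {i, j} = conductance G w {h i, h j}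
        + (\<Sum>c\<in>C. conductance G w {c, h i} * conductance G w {c, h j} / S c)"
  shows "tree_poly G w = (\<Prod>c\<in>C. S c) * tree_poly G' w'"
proof -
  let ?V = "verts G'" and ?c = "conductance G w" and ?L = "laplacian G w"
  \<comment> \<open>The root is taken among the surviving vertices, so all of \<open>C\<close> is
    present in the reduced Laplacian.\<close>
  obtain q where q: "q \<in> ?V" using ne by auto
  have fin: "finite ?V" "finite C"
    using wf h(2) by (auto simp: wf_multigraph_def)
  have hV: "h ` (?V - {q}) = h ` ?V - {h q}"
    using h(1) q by (simp add: inj_on_image_set_diff[of h ?V])
  have diagC: "?L c c = S c" if c: "c \<in> C" for c
  proof -
    have "?L c c = (\<Sum>k\<in>(C - {c}) \<union> h ` ?V. ?c {c, k})"
      using c h wf(1) by (subst laplacian_diag) (auto intro!: sum.cong)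
    also have "\<dots> = (\<Sum>k\<in>C - {c}. ?c {c, k}) + (\<Sum>k\<in>h ` ?V. ?c {c, k})"
      using fin h(3) by (intro sum.union_disjoint) auto
    also have "(\<Sum>k\<in>C - {c}. ?c {c, k}) = 0"
      using c indep by (intro sum.neutral) auto
    finally show ?thesis using S[OF c] h(1) by (simp add: sum.reindex)
  qed
  have offC: "?L c (h x) = - ?c {c, h x}" "?L (h x) c = - ?c {c, h x}" if "c \<in> C" "x \<in> ?V" for c x
  proof -
    have "c \<noteq> h x" using that h(3) by auto
    then show "?L c (h x) = - ?c {c, h x}" "?L (h x) c = - ?c {c, h x}"
      using laplacian_offdiag[OF wf(1), of c "h x" w] laplacian_offdiag[OF wf(1), of "h x" c w]
      by (auto simp: insert_commute)
  qed
  have "tree_poly G w = set_det (verts G - {h q}) ?L"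
    using q h by (intro matrix_tree wf) auto
  also have "verts G - {h q} = C \<union> h ` (?V - {q})"
    using h q by (auto simp: hV)
  also have "set_det \<dots> ?L
      = (\<Prod>c\<in>C. ?L c c) * set_det (h ` (?V - {q})) (\<lambda>i j. ?L i j - (\<Sum>c\<in>C. ?L i c * ?L c j / ?L c c))"
  proof (rule set_det_diagonal_block)
    show "C \<inter> h ` (?V - {q}) = {}" using h(3) by auto
    show "?L c c \<noteq> 0" if "c \<in> C" for c using diagC nz that by auto
    show "?L c d = 0" if "c \<in> C" "d \<in> C" "c \<noteq> d" for c d
      using that indep wf(1) by (simp add: laplacian_offdiag)
  qed (use fin in auto)
  also have "set_det (h ` (?V - {q})) (\<lambda>i j. ?L i j - (\<Sum>c\<in>C. ?L i c * ?L c j / ?L c c))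
      = set_det (?V - {q}) (\<lambda>i j. ?L (h i) (h j) - (\<Sum>c\<in>C. ?L (h i) c * ?L c (h j) / ?L c c))"
    using fin h(1) by (intro set_det_reindex) (auto intro: inj_on_subset)
  also have "\<dots> = set_det (?V - {q}) (laplacian G' w')"
  proof (rule set_det_cong)
    fix i j assume "i \<in> ?V - {q}" "j \<in> ?V - {q}"
    then have ij: "i \<in> ?V" "j \<in> ?V" by auto
    have sum: "(\<Sum>c\<in>C. ?L (h i) c * ?L c (h j) / ?L c c)
        = (\<Sum>c\<in>C. ?c {c, h i} * ?c {c, h j} / S c)"
      using ij by (intro sum.cong) (auto simp: offC diagC)
    show "?L (h i) (h j) - (\<Sum>c\<in>C. ?L (h i) c * ?L c (h j) / ?L c c) = laplacian G' w' i j"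
    proof (cases "i = j")
      case False
      then have "h i \<noteq> h j" using h(1) ij by (auto simp: inj_on_def)
      with False show ?thesis
        using ij mesh[of i j] by (simp add: sum laplacian_offdiag[OF wf(1)] laplacian_offdiag[OF wf(2)])
    next
      \<comment> \<open>Vanishing column sums determine the diagonal: of the conductance between
        \<open>c\<close> and \<open>h i\<close>, its square divided by \<open>S c\<close> is lost to
        the Schur complement, and the remainder is the total of the mesh edges that \<open>c\<close>
        creates at \<open>i\<close>.\<close>
      case True
      have "?L (h i) (h i) = (\<Sum>k\<in>C \<union> h ` (?V - {i}). ?c {h i, k})"
        using ij h wf(1) by (subst laplacian_diag) (auto intro!: sum.cong simp: inj_on_def)
      also have "\<dots> = (\<Sum>k\<in>C. ?c {h i, k}) + (\<Sum>k\<in>h ` (?V - {i}). ?c {h i, k})"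
        using fin h(3) by (intro sum.union_disjoint) auto
      also have "(\<Sum>k\<in>h ` (?V - {i}). ?c {h i, k}) = (\<Sum>k\<in>?V - {i}. ?c {h i, h k})"
        using h(1) by (subst sum.reindex) (auto intro: inj_on_subset)
      finally have L: "?L (h i) (h i) = (\<Sum>c\<in>C. ?c {c, h i}) + (\<Sum>k\<in>?V - {i}. ?c {h i, h k})"
        by (simp add: insert_commute)
      have "laplacian G' w' i i = (\<Sum>k\<in>?V - {i}. ?c {h i, h k})
          + (\<Sum>k\<in>?V - {i}. \<Sum>c\<in>C. ?c {c, h i} * ?c {c, h k} / S c)"
        using ij mesh[of i]
        by (subst laplacian_diag[OF wf(2)]) (auto simp: sum.distrib[symmetric] intro!: sum.cong)
      also have "(\<Sum>k\<in>?V - {i}. \<Sum>c\<in>C. ?c {c, h i} * ?c {c, h k} / S c)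
          = (\<Sum>c\<in>C. \<Sum>k\<in>?V - {i}. ?c {c, h i} * ?c {c, h k} / S c)"
        by (rule sum.swap)
      also have "\<dots> = (\<Sum>c\<in>C. ?c {c, h i} - ?c {c, h i} * ?c {c, h i} / S c)"
      proof (rule sum.cong[OF refl])
        fix c assume c: "c \<in> C"
        have "(\<Sum>k\<in>?V - {i}. ?c {c, h i} * ?c {c, h k} / S c)
            = ?c {c, h i} * (\<Sum>k\<in>?V - {i}. ?c {c, h k}) / S c"
          by (simp add: sum_distrib_left sum_divide_distrib)
        also have "(\<Sum>k\<in>?V - {i}. ?c {c, h k}) = S c - ?c {c, h i}"
          using S[OF c] ij fin by (simp add: sum_diff1)
        finally show "(\<Sum>k\<in>?V - {i}. ?c {c, h i} * ?c {c, h k} / S c)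
            = ?c {c, h i} - ?c {c, h i} * ?c {c, h i} / S c"
          using nz[OF c] by (simp add: field_simps)
      qed
      finally show ?thesis
        using sum L by (simp add: True[symmetric] sum_subtractf)
    qed
  qed
  also have "\<dots> = tree_poly G' w'"
    using q by (intro matrix_tree[symmetric] wf)
  finally show ?thesis using diagC by simp
qed

section \<open>Line graphs and subdivisions\<close>

lemma real_num_spanning_trees: "real (num_spanning_trees G) = tree_poly G (\<lambda>_. 1)"
  by (simp add: num_spanning_trees_def tree_poly_def)

lemma tree_poly_cong:
  assumes "\<And>e. e \<in> edges G \<Longrightarrow> w e = w' e"
  shows "tree_poly G w = tree_poly G w'"
  unfolding tree_poly_def
  using assms by (intro sum.cong prod.cong) (auto simp: spanning_trees_def)

lemma conductance_eq_sum:
  assumes "wf_multigraph G"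
  shows "conductance G w X = (\<Sum>e\<in>edges G. if ends G e = X then w e else 0)"
  unfolding conductance_def
  using assms by (subst sum.inter_filter) (auto simp: wf_multigraph_def)

text \<open>This is \<open>G\<close> with every edge subdivided once. Naming an edge by its
  incidence \<open>(v, e)\<close> lets a weight depend on the original vertex alone.\<close>

definition incidence_graph :: "('v, 'e) multigraph \<Rightarrow> ('v + 'e, 'v \<times> 'e) multigraph" where
  "incidence_graph G =
     \<lparr>verts = Inl ` verts G \<union> Inr ` edges G,
      edges = {(v, e). e \<in> edges G \<and> v \<in> ends G e},
      ends = (\<lambda>(v, e). {Inl v, Inr e})\<rparr>"

lemma verts_incidence_graph: "verts (incidence_graph G) = Inl ` verts G \<union> Inr ` edges G"
  by (simp add: incidence_graph_def)

lemma wf_incidence_graph: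
  assumes "wf_multigraph G"
  shows "wf_multigraph (incidence_graph G)"
proof -
  have "edges (incidence_graph G) \<subseteq> verts G \<times> edges G"
    using assms by (auto simp: wf_multigraph_def incidence_graph_def)
  then have "finite (edges (incidence_graph G))"
    using assms by (auto simp: wf_multigraph_def intro: finite_subset)
  with assms show ?thesis
    by (auto simp: wf_multigraph_def incidence_graph_def)
qed

lemma conductance_incidence_graph:
  "conductance (incidence_graph G) w {Inl v, Inr e} =
     (if e \<in> edges G \<and> v \<in> ends G e then w (v, e) else 0)"
  "conductance (incidence_graph G) w {Inr e, Inl v} =
     (if e \<in> edges G \<and> v \<in> ends G e then w (v, e) else 0)"
  "conductance (incidence_graph G) w {Inl v, Inl v'} = 0"
  "conductance (incidence_graph G) w {Inr e, Inr e'} = 0"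
proof -
  have "{x. x \<in> edges (incidence_graph G) \<and> ends (incidence_graph G) x = {Inl v, Inr e}}
      = (if e \<in> edges G \<and> v \<in> ends G e then {(v, e)} else {})"
    by (auto simp: incidence_graph_def doubleton_eq_iff)
  then show *: "conductance (incidence_graph G) w {Inl v, Inr e} =
      (if e \<in> edges G \<and> v \<in> ends G e then w (v, e) else 0)"
    by (simp add: conductance_def)
  then show "conductance (incidence_graph G) w {Inr e, Inl v} =
      (if e \<in> edges G \<and> v \<in> ends G e then w (v, e) else 0)"
    by (simp add: insert_commute)
  have "{x. x \<in> edges (incidence_graph G) \<and> ends (incidence_graph G) x = {Inl v, Inl v'}} = {}"
    "{x. x \<in> edges (incidence_graph G) \<and> ends (incidence_graph G) x = {Inr e, Inr e'}} = {}"
    by (auto simp: incidence_graph_def doubleton_eq_iff)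
  then show "conductance (incidence_graph G) w {Inl v, Inl v'} = 0"
    "conductance (incidence_graph G) w {Inr e, Inr e'} = 0"
    by (simp_all only: conductance_def sum.empty)
qed

lemma conductance_line_graph:
  assumes "wf_multigraph G" "e \<in> edges G" "e' \<in> edges G" "e \<noteq> e'"
  shows "conductance (line_graph G) (\<lambda>_. 1) {e, e'} = real (card (ends G e \<inter> ends G e'))"
proof -
  have "{x. x \<in> edges (line_graph G) \<and> ends (line_graph G) x = {e, e'}}
      = Pair {e, e'} ` (ends G e \<inter> ends G e')"
    using assms by (auto simp: line_graph_def doubleton_eq_iff)
  then show ?thesis
    by (simp add: conductance_def card_image inj_on_def)
qed

text \<open>Conductance \<open>d\<close> on all edges of a star with \<open>d\<close> leaves turns into conductance
  \<open>d * d / (d * d) = 1\<close> on the edges of the clique that replaces it.\<close>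

lemma tree_poly_incidence_graph_line_graph:
  fixes G :: "('v, 'e) multigraph"
  assumes wf: "wf_multigraph G" and ne: "edges G \<noteq> {}"
    and d: "\<And>v. v \<in> verts G \<Longrightarrow> vertex_degree G v > 0"
  shows "tree_poly (incidence_graph G) (\<lambda>p. real (vertex_degree G (fst p)))
    = (\<Prod>v\<in>verts G. real (vertex_degree G v) ^ 2) * real (num_spanning_trees (line_graph G))"
proof -
  let ?d = "\<lambda>v. real (vertex_degree G v)"
  let ?w = "\<lambda>p. ?d (fst p)"
  \<comment> \<open>A vertex of degree \<open>d\<close> has \<open>d\<close> incidences of
    conductance \<open>d\<close>, in total \<open>d^2\<close>. The value 0 on \<open>Inr\<close> is
    filler, as only \<open>Inl\<close> vertices are eliminated.\<close>
  let ?S = "case_sum (\<lambda>v. ?d v ^ 2) (\<lambda>_. 0) :: 'v + 'e \<Rightarrow> real"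
  have fin: "finite (verts G)" "finite (edges G)"
    using wf by (auto simp: wf_multigraph_def)
  have [simp]: "verts (line_graph G) = edges G" by (simp add: line_graph_def)
  have "tree_poly (incidence_graph G) ?w
      = (\<Prod>c\<in>Inl ` verts G. ?S c) * tree_poly (line_graph G) (\<lambda>_. 1)"
  proof (rule star_mesh[where h = Inr])
    show "(\<Sum>x\<in>verts (line_graph G). conductance (incidence_graph G) ?w {c, Inr x}) = ?S c"
      if "c \<in> Inl ` verts G" for c
    proof -
      from that obtain v where c: "c = Inl v" by auto
      have "(\<Sum>x\<in>edges G. if v \<in> ends G x then ?d v else 0) = (\<Sum>x | x \<in> edges G \<and> v \<in> ends G x. ?d v)"
        using fin by (intro sum.inter_filter[symmetric])
      then show ?thesis
        by (simp add: c conductance_incidence_graph vertex_degree_def power2_eq_square cong: if_cong)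
    qed
    show "?S c \<noteq> 0" if "c \<in> Inl ` verts G" for c
      using that d by fastforce
    show "conductance (line_graph G) (\<lambda>_. 1) {e, e'}
        = conductance (incidence_graph G) ?w {Inr e, Inr e'}
          + (\<Sum>c\<in>Inl ` verts G. conductance (incidence_graph G) ?w {c, Inr e} *
              conductance (incidence_graph G) ?w {c, Inr e'} / ?S c)"
      if "e \<in> verts (line_graph G)" "e' \<in> verts (line_graph G)" "e \<noteq> e'" for e e'
    proof -
      have "(\<Sum>c\<in>Inl ` verts G. conductance (incidence_graph G) ?w {c, Inr e} *
              conductance (incidence_graph G) ?w {c, Inr e'} / ?S c)
          = (\<Sum>v\<in>verts G. if v \<in> ends G e \<inter> ends G e' then 1 else 0)"
        using that
        by (subst sum.reindex)
          (auto simp: d[THEN gr_implies_not0] conductance_incidence_graph power2_eq_square intro!: sum.cong)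
      also have "\<dots> = (\<Sum>v | v \<in> verts G \<and> v \<in> ends G e \<inter> ends G e'. 1)"
        using fin by (intro sum.inter_filter[symmetric])
      also have "{v. v \<in> verts G \<and> v \<in> ends G e \<inter> ends G e'} = ends G e \<inter> ends G e'"
        using wf that by (auto simp: wf_multigraph_def)
      finally show ?thesis
        using that wf by (simp add: conductance_line_graph conductance_incidence_graph)
    qed
    show "conductance (incidence_graph G) ?w {c, d} = 0"
      if "c \<in> Inl ` verts G" "d \<in> Inl ` verts G" "c \<noteq> d" for c d
      using that by (auto simp: conductance_incidence_graph)
  qed (use wf ne in \<open>auto simp: wf_incidence_graph wf_line_graph verts_incidence_graph\<close>)
  also have "(\<Prod>c\<in>Inl ` verts G. ?S c) = (\<Prod>v\<in>verts G. ?d v ^ 2)"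
    by (subst prod.reindex) auto
  finally show ?thesis by (simp add: real_num_spanning_trees)
qed

text \<open>The vertex standing for an edge has just two neighbours, so removing it is the series
  law: resistances \<open>1 / d(u)\<close> and \<open>1 / d(v)\<close> add up to the inverse of
  product over sum.\<close>

lemma tree_poly_incidence_graph:
  fixes G :: "('v, 'e) multigraph"
  assumes wf: "wf_multigraph G" and ne: "verts G \<noteq> {}"
    and d: "\<And>v. v \<in> verts G \<Longrightarrow> d v > 0"
  shows "tree_poly (incidence_graph G) (\<lambda>p. d (fst p))
    = (\<Prod>e\<in>edges G. \<Sum>v\<in>ends G e. d v) *
      tree_poly G (\<lambda>e. (\<Prod>v\<in>ends G e. d v) / (\<Sum>v\<in>ends G e. d v))"
proof -
  let ?w = "\<lambda>p. d (fst p)"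
  let ?S = "case_sum (\<lambda>_. 0) (\<lambda>e. \<Sum>v\<in>ends G e. d v) :: 'v + 'e \<Rightarrow> real"
  let ?u = "\<lambda>e. (\<Prod>v\<in>ends G e. d v) / (\<Sum>v\<in>ends G e. d v)"
  have fin: "finite (verts G)" "finite (edges G)"
    using wf by (auto simp: wf_multigraph_def)
  have ends: "ends G e \<subseteq> verts G" "card (ends G e) = 2" if "e \<in> edges G" for e
    using wf that by (auto simp: wf_multigraph_def)
  have "tree_poly (incidence_graph G) ?w = (\<Prod>c\<in>Inr ` edges G. ?S c) * tree_poly G ?u"
  proof (rule star_mesh[where h = Inl])
    show "(\<Sum>x\<in>verts G. conductance (incidence_graph G) ?w {c, Inl x}) = ?S c"
      if "c \<in> Inr ` edges G" for c
    proof -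
      from that obtain e where c: "c = Inr e" and e: "e \<in> edges G" by auto
      have "(\<Sum>x\<in>verts G. if x \<in> ends G e then d x else 0) = (\<Sum>x | x \<in> verts G \<and> x \<in> ends G e. d x)"
        using fin by (intro sum.inter_filter[symmetric])
      also have "{x. x \<in> verts G \<and> x \<in> ends G e} = ends G e"
        using ends[OF e] by auto
      finally show ?thesis
        using e by (simp add: c conductance_incidence_graph cong: if_cong)
    qed
    show "?S c \<noteq> 0" if "c \<in> Inr ` edges G" for c
    proof -
      from that obtain e where c: "c = Inr e" and e: "e \<in> edges G" by auto
      have "(\<Sum>v\<in>ends G e. d v) > 0"
        using ends[OF e] d by (intro sum_pos) (auto intro: card_ge_0_finite)
      then show ?thesis by (simp add: c)
    qed
    show "conductance G ?u {x, y}
        = conductance (incidence_graph G) ?w {Inl x, Inl y}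
          + (\<Sum>c\<in>Inr ` edges G. conductance (incidence_graph G) ?w {c, Inl x} *
              conductance (incidence_graph G) ?w {c, Inl y} / ?S c)"
      if "x \<in> verts G" "y \<in> verts G" "x \<noteq> y" for x y
    proof -
      have iff: "ends G e = {x, y} \<longleftrightarrow> x \<in> ends G e \<and> y \<in> ends G e" if "e \<in> edges G" for e
        using ends(2)[OF that] \<open>x \<noteq> y\<close> by (auto simp: card_2_iff)
      have "(\<Sum>c\<in>Inr ` edges G. conductance (incidence_graph G) ?w {c, Inl x} *
              conductance (incidence_graph G) ?w {c, Inl y} / ?S c)
          = (\<Sum>e\<in>edges G. if ends G e = {x, y} then d x * d y / (\<Sum>v\<in>ends G e. d v) else 0)"
        by (subst sum.reindex) (auto simp: conductance_incidence_graph iff intro!: sum.cong)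
      also have "\<dots> = conductance G ?u {x, y}"
        unfolding conductance_eq_sum[OF wf] using \<open>x \<noteq> y\<close> by (intro sum.cong) auto
      finally show ?thesis by (simp add: conductance_incidence_graph)
    qed
    show "conductance (incidence_graph G) ?w {c, d} = 0"
      if "c \<in> Inr ` edges G" "d \<in> Inr ` edges G" "c \<noteq> d" for c d
      using that by (auto simp: conductance_incidence_graph)
  qed (use wf ne in \<open>auto simp: wf_incidence_graph verts_incidence_graph\<close>)
  also have "(\<Prod>c\<in>Inr ` edges G. ?S c) = (\<Prod>e\<in>edges G. \<Sum>v\<in>ends G e. d v)"
    by (subst prod.reindex) auto
  finally show ?thesis .
qed

section \<open>Subdivided edges as resistances in series\<close>

lemma verts_subdivision: "verts (subdivision r G) = Inl ` verts G \<union> Inr ` (edges G \<times> {1..r})"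
  by (simp add: subdivision_def)

lemma conductance_subdivision:
  assumes "wf_multigraph G"
  shows "conductance (subdivision r G) w X
    = (\<Sum>e\<in>edges G. \<Sum>i<Suc r. if {path_vertex r G e i, path_vertex r G e (Suc i)} = X then w (e, i) else 0)"
proof -
  have "{0..r} = {..<Suc r}" by auto
  then show ?thesis
    unfolding conductance_eq_sum[OF wf_subdivision[OF assms]]
    by (simp add: subdivision_def sum.cartesian_product split_def del: sum.lessThan_Suc cong: if_cong)
qed

text \<open>Here \<open>star_mesh\<close> eliminates nothing and serves as invariance under the
  relabelling \<open>Inl\<close>.\<close>

lemma tree_poly_subdivision_0:
  fixes G :: "('v, 'e) multigraph"
  assumes wf: "wf_multigraph G" and ne: "verts G \<noteq> {}"
  shows "tree_poly (subdivision 0 G) w = tree_poly G (\<lambda>e. w (e, 0))"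
proof -
  have "tree_poly (subdivision 0 G) w = (\<Prod>c\<in>({} :: ('v + 'e \<times> nat) set). 0) * tree_poly G (\<lambda>e. w (e, 0))"
  proof (rule star_mesh[where h = Inl])
    show "conductance G (\<lambda>e. w (e, 0)) {x, y} = conductance (subdivision 0 G) w {Inl x, Inl y} +
        (\<Sum>c\<in>({} :: ('v + 'e \<times> nat) set). conductance (subdivision 0 G) w {c, Inl x} *
          conductance (subdivision 0 G) w {c, Inl y} / 0)" for x y
    proof -
      have iff: "ends G e = {x, y} \<longleftrightarrow> {Inl (end1 G e), Inl (end2 G e)} = {Inl x, Inl y}"
        if "e \<in> edges G" for e
        using ends_eq_end1_end2(1)[OF wf that] by (auto simp: doubleton_eq_iff)
      then show ?thesis
        unfolding conductance_subdivision[OF wf] conductance_eq_sum[OF wf]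
        by (simp add: path_vertex_def, intro sum.cong refl if_cong iff)
    qed
  qed (use wf ne in \<open>auto simp: wf_subdivision verts_subdivision\<close>)
  then show ?thesis by simp
qed

text \<open>The last new vertex of every path is eliminated at once, which is possible because these
  vertices lie on different paths and are never adjacent. The edges \<open>j\<close> and
  \<open>Suc j\<close> of the path merge into edge \<open>j\<close> of the shorter one.\<close>

lemma tree_poly_subdivision_Suc:
  fixes G :: "('v, 'e) multigraph" and w :: "'e \<times> nat \<Rightarrow> real" and j :: nat
  assumes wf: "wf_multigraph G" and ne: "verts G \<noteq> {}"
    and pos: "\<And>e i. e \<in> edges G \<Longrightarrow> w (e, i) > 0"
  defines "w' \<equiv> \<lambda>(e, i). if i = j then w (e, j) * w (e, Suc j) / (w (e, j) + w (e, Suc j)) else w (e, i)"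
  shows "tree_poly (subdivision (Suc j) G) w
    = (\<Prod>e\<in>edges G. w (e, j) + w (e, Suc j)) * tree_poly (subdivision j G) w'"
proof -
  let ?S = "case_sum (\<lambda>_. 0) (\<lambda>(e, i). w (e, j) + w (e, Suc j)) :: 'v + 'e \<times> nat \<Rightarrow> real"
  let ?c = "conductance (subdivision (Suc j) G) w"
  let ?C = "(\<lambda>e. Inr (e, Suc j)) ` edges G :: ('v + 'e \<times> nat) set"
  \<comment> \<open>\<open>P e\<close> and \<open>Q e\<close> are the neighbours of the eliminated
    vertex on the path of \<open>e\<close>. For \<open>j = 0\<close>, \<open>P e\<close> is the
    first end of \<open>e\<close> itself.\<close>
  define P where "P e = path_vertex j G e j" for e
  define Q where "Q e = (Inl (end2 G e) :: 'v + 'e \<times> nat)" for e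
  have fin: "finite (verts G)" "finite (edges G)"
    using wf by (auto simp: wf_multigraph_def)
  have fin': "finite (verts (subdivision j G))"
    using wf_subdivision[OF wf] by (auto simp: wf_multigraph_def)
  \<comment> \<open>Positions up to \<open>j\<close> carry the same names in both subdivisions;
    position \<open>Suc j\<close> is a new vertex in the longer path but the second end of
    \<open>e\<close> in the shorter one.\<close>
  have pv: "path_vertex (Suc j) G e i = path_vertex j G e i" if "i \<le> j" for e i
    using that by (auto simp: path_vertex_def)
  have pvj: "path_vertex (Suc j) G e j = P e" "path_vertex j G e j = P e" for e
    using pv[of j e] by (auto simp: P_def)
  have pvS: "path_vertex (Suc j) G e (Suc j) = Inr (e, Suc j)"
    "path_vertex (Suc j) G e (Suc (Suc j)) = Q e" "path_vertex j G e (Suc j) = Q e" for e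
    by (auto simp: path_vertex_def Q_def)
  have ends: "end1 G e \<in> verts G" "end2 G e \<in> verts G" "end1 G e \<noteq> end2 G e" if "e \<in> edges G" for e
    using ends_eq_end1_end2[OF wf that] wf that by (auto simp: wf_multigraph_def)
  have PQ: "P e \<in> verts (subdivision j G)" "Q e \<in> verts (subdivision j G)" "P e \<noteq> Q e"
    if "e \<in> edges G" for e
    using ends[OF that] that by (auto simp: P_def Q_def path_vertex_def subdivision_def)
  have new: "Inr (e, Suc j) \<notin> verts (subdivision j G)" for e
    by (auto simp: subdivision_def)
  have old: "path_vertex j G e i \<noteq> Inr (e', Suc j)" for e e' i
    by (auto simp: path_vertex_def)
  have cS: "?c X = (\<Sum>e\<in>edges G.
      (\<Sum>i<j. if {path_vertex j G e i, path_vertex j G e (Suc i)} = X then w (e, i) else 0)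
      + (if {P e, Inr (e, Suc j)} = X then w (e, j) else 0)
      + (if {Inr (e, Suc j), Q e} = X then w (e, Suc j) else 0))" for X
    unfolding conductance_subdivision[OF wf] by (simp add: pv pvj pvS)
  have c_new: "?c {Inr (e, Suc j), x} = (if x = P e then w (e, j) else 0) + (if x = Q e then w (e, Suc j) else 0)"
    if e: "e \<in> edges G" and x: "x \<in> verts (subdivision j G)" for e x
  proof -
    have xn: "x \<noteq> Inr (e', Suc j)" for e'
      using x new by auto
    have PQn: "P e' \<noteq> Inr (e'', Suc j)" "Q e' \<noteq> Inr (e'', Suc j)" for e' e''
      by (auto simp: P_def Q_def old)
    have "?c {Inr (e, Suc j), x} = (\<Sum>e'\<in>edges G. if e' = e then
        (if x = P e then w (e, j) else 0) + (if x = Q e then w (e, Suc j) else 0) else 0)"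
      unfolding cS
    proof (rule sum.cong[OF refl])
      fix e' assume "e' \<in> edges G"
      have "(\<Sum>i<j. if {path_vertex j G e' i, path_vertex j G e' (Suc i)} = {Inr (e, Suc j), x}
          then w (e', i) else 0) = 0"
        by (intro sum.neutral) (auto simp: doubleton_eq_iff old)
      moreover have "{P e', Inr (e', Suc j)} = {Inr (e, Suc j), x} \<longleftrightarrow> e' = e \<and> x = P e"
        using PQn xn by (auto simp: doubleton_eq_iff)
      moreover have "{Inr (e', Suc j), Q e'} = {Inr (e, Suc j), x} \<longleftrightarrow> e' = e \<and> x = Q e"
        using PQn xn by (auto simp: doubleton_eq_iff)
      ultimately show "(\<Sum>i<j. if {path_vertex j G e' i, path_vertex j G e' (Suc i)} = {Inr (e, Suc j), x}
          then w (e', i) else 0)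
        + (if {P e', Inr (e', Suc j)} = {Inr (e, Suc j), x} then w (e', j) else 0)
        + (if {Inr (e', Suc j), Q e'} = {Inr (e, Suc j), x} then w (e', Suc j) else 0)
        = (if e' = e then (if x = P e then w (e, j) else 0) + (if x = Q e then w (e, Suc j) else 0) else 0)"
        by auto
    qed
    then show ?thesis using e fin by simp
  qed
  have c_old: "?c {x, y} = (\<Sum>e\<in>edges G. \<Sum>i<j.
      if {path_vertex j G e i, path_vertex j G e (Suc i)} = {x, y} then w (e, i) else 0)"
    if "x \<in> verts (subdivision j G)" "y \<in> verts (subdivision j G)" for x y
  proof -
    have "{P e, Inr (e, Suc j)} \<noteq> {x, y}" "{Inr (e, Suc j), Q e} \<noteq> {x, y}" for e
      using that new by (metis insertCI insertE singletonD)+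
    then show ?thesis unfolding cS by simp
  qed
  have "tree_poly (subdivision (Suc j) G) w = (\<Prod>c\<in>?C. ?S c) * tree_poly (subdivision j G) w'"
  proof (rule star_mesh[where h = "\<lambda>x. x"])
    show "verts (subdivision (Suc j) G) = ?C \<union> (\<lambda>x. x) ` verts (subdivision j G)"
      by (auto simp: subdivision_def image_iff le_Suc_eq)
    show "?C \<inter> (\<lambda>x. x) ` verts (subdivision j G) = {}"
      using new by auto
    show "?c {c, d} = 0" if "c \<in> ?C" "d \<in> ?C" "c \<noteq> d" for c d
    proof -
      have "{path_vertex j G e i, path_vertex j G e (Suc i)} \<noteq> {c, d}"
        "{P e, Inr (e, Suc j)} \<noteq> {c, d}" "{Inr (e, Suc j), Q e} \<noteq> {c, d}" for e i
        using that old by (auto simp: P_def Q_def doubleton_eq_iff)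
      then show ?thesis unfolding cS by simp
    qed
    show "(\<Sum>x\<in>verts (subdivision j G). ?c {c, x}) = ?S c" if "c \<in> ?C" for c
    proof -
      from that obtain e where c: "c = Inr (e, Suc j)" "e \<in> edges G" by auto
      have "(\<Sum>x\<in>verts (subdivision j G). ?c {c, x})
          = (\<Sum>x\<in>verts (subdivision j G). (if x = P e then w (e, j) else 0) + (if x = Q e then w (e, Suc j) else 0))"
        unfolding c(1) using c(2) by (intro sum.cong refl c_new)
      also have "\<dots> = ?S c"
        using PQ[OF c(2)] fin' by (simp add: c sum.distrib)
      finally show ?thesis .
    qed
    show "?S c \<noteq> 0" if "c \<in> ?C" for c
      using that pos by (auto simp: add_pos_pos less_imp_neq[symmetric])
    show "conductance (subdivision j G) w' {x, y} = ?c {x, y} + (\<Sum>c\<in>?C. ?c {c, x} * ?c {c, y} / ?S c)"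
      if xy: "x \<in> verts (subdivision j G)" "y \<in> verts (subdivision j G)" "x \<noteq> y" for x y
    proof -
      have "(\<Sum>c\<in>?C. ?c {c, x} * ?c {c, y} / ?S c)
          = (\<Sum>e\<in>edges G. ?c {Inr (e, Suc j), x} * ?c {Inr (e, Suc j), y} / (w (e, j) + w (e, Suc j)))"
        by (subst sum.reindex) (auto simp: inj_on_def)
      \<comment> \<open>Since \<open>x\<close> and \<open>y\<close> differ, both conductances are
        nonzero only if \<open>x\<close> and \<open>y\<close> are the two neighbours in some
        order.\<close>
      also have "\<dots> = (\<Sum>e\<in>edges G. if {P e, Q e} = {x, y} then w' (e, j) else 0)"
        using xy PQ(3) by (intro sum.cong) (auto simp: c_new w'_def doubleton_eq_iff)
      finally have *: "(\<Sum>c\<in>?C. ?c {c, x} * ?c {c, y} / ?S c)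
          = (\<Sum>e\<in>edges G. if {P e, Q e} = {x, y} then w' (e, j) else 0)" .
      have "(\<Sum>i<j. if {path_vertex j G e i, path_vertex j G e (Suc i)} = {x, y} then w' (e, i) else 0)
          = (\<Sum>i<j. if {path_vertex j G e i, path_vertex j G e (Suc i)} = {x, y} then w (e, i) else 0)" for e
        by (intro sum.cong) (auto simp: w'_def)
      then show ?thesis
        unfolding * c_old[OF xy(1,2)] unfolding conductance_subdivision[OF wf]
        by (simp add: pvj pvS sum.distrib)
    qed
  qed (use wf ne in \<open>auto simp: wf_subdivision verts_subdivision\<close>)
  also have "(\<Prod>c\<in>?C. ?S c) = (\<Prod>e\<in>edges G. w (e, j) + w (e, Suc j))"
    by (subst prod.reindex) (auto simp: inj_on_def)
  finally show ?thesis .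
qed

text \<open>Merging keeps the total resistance of a path, and the pivot \<open>a + b\<close> times
  the merged conductance \<open>a b / (a + b)\<close> is \<open>a b\<close>. For a path of length 1
  the prefactor is \<open>w * (1 / w) = 1\<close>.\<close>

theorem tree_poly_subdivision:
  fixes w :: "'e \<times> nat \<Rightarrow> real"
  assumes wf: "wf_multigraph G" and ne: "verts G \<noteq> {}"
    and pos: "\<And>e i. e \<in> edges G \<Longrightarrow> w (e, i) > 0"
  shows "tree_poly (subdivision r G) w
    = (\<Prod>e\<in>edges G. (\<Prod>i<Suc r. w (e, i)) * (\<Sum>i<Suc r. 1 / w (e, i))) *
      tree_poly G (\<lambda>e. 1 / (\<Sum>i<Suc r. 1 / w (e, i)))"
  using pos
proof (induction r arbitrary: w)
  case 0
  have "w (e, 0) \<noteq> 0" if "e \<in> edges G" for e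
    using 0[OF that, of 0] by simp
  then show ?case
    using tree_poly_subdivision_0[OF wf ne] by simp
next
  case (Suc r)
  define w' where "w' = (\<lambda>(e, i). if i = r then w (e, r) * w (e, Suc r) / (w (e, r) + w (e, Suc r)) else w (e, i))"
  have pos': "w' (e, i) > 0" if "e \<in> edges G" for e i
    using Suc.prems[OF that] by (auto simp: w'_def add_pos_pos)
  have sums: "(\<Sum>i<Suc r. 1 / w' (e, i)) = (\<Sum>i<Suc (Suc r). 1 / w (e, i))" if "e \<in> edges G" for e
  proof -
    have "(\<Sum>i<r. 1 / w' (e, i)) = (\<Sum>i<r. 1 / w (e, i))"
      by (intro sum.cong) (auto simp: w'_def)
    moreover have "1 / w' (e, r) = 1 / w (e, r) + 1 / w (e, Suc r)"
      using Suc.prems[OF that, of r] Suc.prems[OF that, of "Suc r"] by (simp add: w'_def field_simps)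
    ultimately show ?thesis by simp
  qed
  have prods: "(w (e, r) + w (e, Suc r)) * (\<Prod>i<Suc r. w' (e, i)) = (\<Prod>i<Suc (Suc r). w (e, i))"
    if "e \<in> edges G" for e
  proof -
    have "(\<Prod>i<r. w' (e, i)) = (\<Prod>i<r. w (e, i))"
      by (intro prod.cong) (auto simp: w'_def)
    moreover have "w (e, r) + w (e, Suc r) \<noteq> 0"
      using Suc.prems[OF that, of r] Suc.prems[OF that, of "Suc r"] by linarith
    ultimately show ?thesis by (simp add: w'_def)
  qed
  have "tree_poly (subdivision (Suc r) G) w
      = (\<Prod>e\<in>edges G. w (e, r) + w (e, Suc r)) * tree_poly (subdivision r G) w'"
    unfolding w'_def by (rule tree_poly_subdivision_Suc[OF wf ne]) (rule Suc.prems)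
  also have "tree_poly (subdivision r G) w'
      = (\<Prod>e\<in>edges G. (\<Prod>i<Suc r. w' (e, i)) * (\<Sum>i<Suc r. 1 / w' (e, i))) *
        tree_poly G (\<lambda>e. 1 / (\<Sum>i<Suc r. 1 / w' (e, i)))"
    by (rule Suc.IH) (rule pos')
  also have "tree_poly G (\<lambda>e. 1 / (\<Sum>i<Suc r. 1 / w' (e, i)))
      = tree_poly G (\<lambda>e. 1 / (\<Sum>i<Suc (Suc r). 1 / w (e, i)))"
    unfolding tree_poly_def
    by (intro sum.cong prod.cong refl) (auto simp: spanning_trees_def sums simp del: sum.lessThan_Suc cong: if_cong)
  finally show ?case
    unfolding mult.assoc[symmetric] prod.distrib[symmetric]
    by (simp only: sums prods mult.assoc[symmetric] cong: prod.cong)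
qed

section \<open>Line graphs in terms of degrees\<close>

text \<open>One weighted incidence graph is reduced in two ways, to the line graph and to
  \<open>G\<close>, and the results are compared.\<close>

lemma num_spanning_trees_line_graph:
  fixes G :: "('v, 'e) multigraph"
  assumes wf: "wf_multigraph G" and ne: "verts G \<noteq> {}"
    and d: "\<And>v. v \<in> verts G \<Longrightarrow> vertex_degree G v > 0"
  defines "d \<equiv> \<lambda>v. real (vertex_degree G v)"
  shows "(\<Prod>v\<in>verts G. d v ^ 2) * real (num_spanning_trees (line_graph G))
    = (\<Prod>e\<in>edges G. \<Sum>v\<in>ends G e. d v) *
      tree_poly G (\<lambda>e. (\<Prod>v\<in>ends G e. d v) / (\<Sum>v\<in>ends G e. d v))"
proof -
  \<comment> \<open>Reduction to the line graph needs an edge of \<open>G\<close> that can serve as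
    root.\<close>
  obtain v where "v \<in> verts G" using ne by auto
  then have "card {e \<in> edges G. v \<in> ends G e} > 0"
    using d by (simp add: vertex_degree_def)
  then have "edges G \<noteq> {}" by (auto simp: card_gt_0_iff)
  then show ?thesis
    using tree_poly_incidence_graph_line_graph[OF wf _ d] tree_poly_incidence_graph[OF wf ne, of d] d
    by (simp add: d_def)
qed

lemma vertex_degree_subdivision:
  fixes G :: "('v, 'e) multigraph"
  assumes wf: "wf_multigraph G"
  shows "v \<in> verts G \<Longrightarrow> vertex_degree (subdivision r G) (Inl v) = vertex_degree G v"
    and "x \<in> edges G \<times> {1..r} \<Longrightarrow> vertex_degree (subdivision r G) (Inr x) = 2"
proof -
  assume v: "v \<in> verts G"
  \<comment> \<open>On the path of an incident edge, \<open>v\<close> meets the first piece, with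
    index 0, or the last one, with index \<open>r\<close>.\<close>
  let ?f = "\<lambda>e. (e, if v = end1 G e then 0 else r)"
  have "{x \<in> edges (subdivision r G). Inl v \<in> ends (subdivision r G) x}
      = ?f ` {e \<in> edges G. v \<in> ends G e}"
    using ends_eq_end1_end2[OF wf] ends_eq_end1_end2(2)[OF wf, THEN not_sym]
    by (auto simp: subdivision_def path_vertex_def image_iff split: if_splits)
  then show "vertex_degree (subdivision r G) (Inl v) = vertex_degree G v"
    by (simp add: vertex_degree_def card_image inj_on_def)
next
  assume x: "x \<in> edges G \<times> {1..r}"
  then obtain e i where ei: "x = (e, Suc i)" "e \<in> edges G" "Suc i \<le> r"
    by (metis One_nat_def SigmaE Suc_le_D atLeastAtMost_iff)
  have "{y \<in> edges (subdivision r G). Inr x \<in> ends (subdivision r G) y} = {(e, i), (e, Suc i)}"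
    using ei by (auto simp: subdivision_def path_vertex_def split: if_splits)
  then show "vertex_degree (subdivision r G) (Inr x) = 2"
    by (simp add: vertex_degree_def)
qed

text \<open>Multiplicative form of the handshake lemma: every vertex contributes one factor per
  incident edge.\<close>

lemma prod_edges_ends:
  fixes d :: "'v \<Rightarrow> real"
  assumes "wf_multigraph G"
  shows "(\<Prod>e\<in>edges G. \<Prod>v\<in>ends G e. d v) = (\<Prod>v\<in>verts G. d v ^ vertex_degree G v)"
proof -
  have fin: "finite (verts G)" "finite (edges G)"
    using assms by (auto simp: wf_multigraph_def)
  have "(\<Prod>v\<in>ends G e. d v) = (\<Prod>v | v \<in> verts G \<and> v \<in> ends G e. d v)" if "e \<in> edges G" for e
    using assms that by (intro prod.cong) (auto simp: wf_multigraph_def)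
  then have "(\<Prod>e\<in>edges G. \<Prod>v\<in>ends G e. d v)
      = (\<Prod>e\<in>edges G. \<Prod>v | v \<in> verts G \<and> v \<in> ends G e. d v)" by simp
  also have "\<dots> = (\<Prod>v\<in>verts G. \<Prod>e | e \<in> edges G \<and> v \<in> ends G e. d v)"
    using fin by (intro prod.swap_restrict)
  finally show ?thesis by (simp add: vertex_degree_def)
qed

lemma sum_vertex_degree:
  assumes "wf_multigraph G"
  shows "(\<Sum>v\<in>verts G. vertex_degree G v) = 2 * card (edges G)"
proof -
  have fin: "finite (verts G)" "finite (edges G)"
    using assms by (auto simp: wf_multigraph_def)
  have "(\<Sum>v\<in>verts G. vertex_degree G v) = (\<Sum>v\<in>verts G. \<Sum>e | e \<in> edges G \<and> v \<in> ends G e. 1)"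
    by (simp add: vertex_degree_def)
  also have "\<dots> = (\<Sum>e\<in>edges G. \<Sum>v | v \<in> verts G \<and> v \<in> ends G e. 1)"
    using fin by (intro sum.swap_restrict)
  also have "\<dots> = (\<Sum>e\<in>edges G. 2)"
  proof (rule sum.cong[OF refl])
    fix e assume "e \<in> edges G"
    then have "{v. v \<in> verts G \<and> v \<in> ends G e} = ends G e" "card (ends G e) = 2"
      using assms by (auto simp: wf_multigraph_def)
    then show "(\<Sum>v | v \<in> verts G \<and> v \<in> ends G e. 1) = (2 :: nat)" by simp
  qed
  finally show ?thesis by simp
qed

text \<open>Here \<open>r + 1 / d(u) + 1 / d(v)\<close> is the resistance of the path replacing an
  edge. It appears for the edges outside a tree because the product of all resistances is pulled
  into the sum.\<close>

theorem num_spanning_trees_line_graph_subdivision: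
  fixes G :: "('v, 'e) multigraph"
  assumes wf: "wf_multigraph G" and ne: "verts G \<noteq> {}"
    and pos: "\<And>v. v \<in> verts G \<Longrightarrow> vertex_degree G v > 0"
  defines "d \<equiv> \<lambda>v. real (vertex_degree G v)"
  shows "(\<Prod>v\<in>verts G. d v ^ 2) * real (num_spanning_trees (line_graph (subdivision r G)))
    = (\<Prod>v\<in>verts G. d v ^ vertex_degree G v) *
      (\<Sum>T\<in>spanning_trees G. \<Prod>e\<in>edges G - T. real r + (\<Sum>v\<in>ends G e. 1 / d v))"
proof -
  let ?H = "subdivision r G"
  \<comment> \<open>\<open>D\<close> gives the degrees in \<open>S_r(G)\<close>;
    \<open>p / s\<close> is the conductance of a piece of a path and \<open>R\<close> the resistance
    of the whole path.\<close>
  define D :: "'v + 'e \<times> nat \<Rightarrow> real" where "D = case_sum d (\<lambda>_. 2)"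
  define p where "p e i = D (path_vertex r G e i) * D (path_vertex r G e (Suc i))" for e i
  define s where "s e i = D (path_vertex r G e i) + D (path_vertex r G e (Suc i))" for e i
  define R where "R e = real r + (\<Sum>v\<in>ends G e. 1 / d v)" for e
  have fin: "finite (verts G)" "finite (edges G)"
    using wf by (auto simp: wf_multigraph_def)
  have wfH: "wf_multigraph ?H" by (rule wf_subdivision[OF wf])
  have degH: "real (vertex_degree ?H x) = D x" if "x \<in> verts ?H" for x
    using that vertex_degree_subdivision[OF wf] by (auto simp: verts_subdivision D_def d_def)
  have dpos: "d v > 0" if "v \<in> verts G" for v
    using pos[OF that] by (simp add: d_def)
  have endsG: "ends G e = {end1 G e, end2 G e}" "end1 G e \<noteq> end2 G e"
    "end1 G e \<in> verts G" "end2 G e \<in> verts G" if "e \<in> edges G" for e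
    using ends_eq_end1_end2[OF wf that] wf that by (auto simp: wf_multigraph_def)
  have Dpos: "D (path_vertex r G e i) > 0" if "e \<in> edges G" for e i
    using endsG[OF that] dpos by (auto simp: D_def path_vertex_def)
  have spos: "s e i > 0" and ppos: "p e i > 0" if "e \<in> edges G" for e i
    using Dpos[OF that] by (auto simp: s_def p_def add_pos_pos)
  have Rpos: "R e > 0" if "e \<in> edges G" for e
    using endsG[OF that] dpos by (simp add: R_def add_nonneg_pos add_pos_pos)
  have ends_prod: "(\<Prod>x\<in>ends ?H (e, i). real (vertex_degree ?H x)) = p e i"
    and ends_sum: "(\<Sum>x\<in>ends ?H (e, i). real (vertex_degree ?H x)) = s e i"
    if "e \<in> edges G" "i < Suc r" for e i
  proof -
    have ei: "(e, i) \<in> edges ?H" using that by (auto simp: subdivision_def)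
    have ends: "ends ?H (e, i) = {path_vertex r G e i, path_vertex r G e (Suc i)}"
      by (simp add: subdivision_def)
    have "card (ends ?H (e, i)) = 2" "ends ?H (e, i) \<subseteq> verts ?H"
      using wfH ei by (auto simp: wf_multigraph_def)
    then have "path_vertex r G e i \<noteq> path_vertex r G e (Suc i)"
      "path_vertex r G e i \<in> verts ?H" "path_vertex r G e (Suc i) \<in> verts ?H"
      unfolding ends by (auto simp: card_2_iff doubleton_eq_iff)
    then show "(\<Prod>x\<in>ends ?H (e, i). real (vertex_degree ?H x)) = p e i"
      "(\<Sum>x\<in>ends ?H (e, i). real (vertex_degree ?H x)) = s e i"
      unfolding ends by (auto simp: degH p_def s_def)
  qed
  have edgesH: "edges ?H = edges G \<times> {..<Suc r}"
    by (auto simp: subdivision_def)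
  have prodH: "(\<Prod>x\<in>edges ?H. g x) = (\<Prod>e\<in>edges G. \<Prod>i<Suc r. g (e, i))" for g :: "_ \<Rightarrow> real"
    unfolding edgesH by (simp add: prod.cartesian_product split_def del: prod.lessThan_Suc)
  have vertsH: "(\<Prod>x\<in>verts ?H. g x) = (\<Prod>v\<in>verts G. g (Inl v)) * (\<Prod>x\<in>edges G \<times> {1..r}. g (Inr x))"
    for g :: "_ \<Rightarrow> real"
    unfolding verts_subdivision using fin
    by (subst prod.union_disjoint) (auto simp: prod.reindex)
  define w where "w = (\<lambda>(e, i). p e i / s e i)"
  \<comment> \<open>A piece has resistance \<open>1 / D\<close> summed over its two ends. Each of
    the \<open>r\<close> inner vertices belongs to two pieces and contributes twice
    \<open>1 / 2\<close>; the two outer ends are counted once.\<close>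
  have sumR: "(\<Sum>i<Suc r. 1 / w (e, i)) = R e" if e: "e \<in> edges G" for e
  proof -
    let ?g = "\<lambda>i. 1 / D (path_vertex r G e i)"
    have inner: "(\<Sum>i<r. ?g (Suc i)) = real r / 2"
      by (subst sum.cong[where h = "\<lambda>_. 1 / 2"]) (auto simp: D_def path_vertex_def)
    have "1 / w (e, i) = ?g i + ?g (Suc i)" for i
      using Dpos[OF e, of i] Dpos[OF e, of "Suc i"] by (simp add: w_def p_def s_def field_simps)
    then have "(\<Sum>i<Suc r. 1 / w (e, i)) = (\<Sum>i<Suc r. ?g i) + (\<Sum>i<Suc r. ?g (Suc i))"
      by (simp only: sum.distrib)
    also have "(\<Sum>i<Suc r. ?g i) = ?g 0 + real r / 2"
      unfolding sum.lessThan_Suc_shift inner ..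
    also have "(\<Sum>i<Suc r. ?g (Suc i)) = real r / 2 + ?g (Suc r)"
      unfolding sum.lessThan_Suc inner ..
    finally show ?thesis
      using endsG[OF e] by (simp add: R_def D_def path_vertex_def)
  qed
  have "(\<Prod>x\<in>verts ?H. real (vertex_degree ?H x) ^ 2) * real (num_spanning_trees (line_graph ?H))
      = (\<Prod>x\<in>edges ?H. \<Sum>y\<in>ends ?H x. real (vertex_degree ?H y)) *
        tree_poly ?H (\<lambda>x. (\<Prod>y\<in>ends ?H x. real (vertex_degree ?H y)) /
          (\<Sum>y\<in>ends ?H x. real (vertex_degree ?H y)))"
  proof (rule num_spanning_trees_line_graph[OF wfH])
    show "verts ?H \<noteq> {}" using ne by (auto simp: verts_subdivision)
    show "vertex_degree ?H x > 0" if "x \<in> verts ?H" for x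
      using that vertex_degree_subdivision[OF wf] pos by (auto simp: verts_subdivision)
  qed
  also have "tree_poly ?H (\<lambda>x. (\<Prod>y\<in>ends ?H x. real (vertex_degree ?H y)) /
      (\<Sum>y\<in>ends ?H x. real (vertex_degree ?H y))) = tree_poly ?H w"
    by (intro tree_poly_cong) (auto simp: w_def edgesH ends_prod ends_sum)
  also have "\<dots> = (\<Prod>e\<in>edges G. (\<Prod>i<Suc r. w (e, i)) * R e) * tree_poly G (\<lambda>e. 1 / R e)"
  proof -
    have "tree_poly ?H w = (\<Prod>e\<in>edges G. (\<Prod>i<Suc r. w (e, i)) * (\<Sum>i<Suc r. 1 / w (e, i))) *
        tree_poly G (\<lambda>e. 1 / (\<Sum>i<Suc r. 1 / w (e, i)))"
      by (rule tree_poly_subdivision[OF wf ne]) (simp add: w_def spos ppos)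
    also have "tree_poly G (\<lambda>e. 1 / (\<Sum>i<Suc r. 1 / w (e, i))) = tree_poly G (\<lambda>e. 1 / R e)"
      by (intro tree_poly_cong) (simp only: sumR)
    finally show ?thesis
      by (simp only: sumR cong: prod.cong)
  qed
  also have "(\<Prod>x\<in>edges ?H. \<Sum>y\<in>ends ?H x. real (vertex_degree ?H y))
      = (\<Prod>e\<in>edges G. \<Prod>i<Suc r. s e i)"
    unfolding prodH by (intro prod.cong) (auto simp: ends_sum)
  \<comment> \<open>The edge pivots \<open>s\<close> cancel the denominators of
    \<open>w = p / s\<close>.\<close>
  also have "\<dots> * ((\<Prod>e\<in>edges G. (\<Prod>i<Suc r. w (e, i)) * R e) * tree_poly G (\<lambda>e. 1 / R e))
      = (\<Prod>e\<in>edges G. \<Prod>i<Suc r. p e i) * ((\<Prod>e\<in>edges G. R e) * tree_poly G (\<lambda>e. 1 / R e))"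
  proof -
    have sw: "(\<Prod>i<Suc r. s e i) * (\<Prod>i<Suc r. w (e, i)) = (\<Prod>i<Suc r. p e i)" if "e \<in> edges G" for e
      unfolding prod.distrib[symmetric]
      using that spos[OF that] by (intro prod.cong) (auto simp: w_def less_imp_neq[symmetric])
    have "(\<Prod>e\<in>edges G. \<Prod>i<Suc r. s e i) * (\<Prod>e\<in>edges G. \<Prod>i<Suc r. w (e, i))
        = (\<Prod>e\<in>edges G. \<Prod>i<Suc r. p e i)"
      by (subst prod.distrib[symmetric]) (rule prod.cong[OF refl], rule sw)
    then show ?thesis by (simp only: prod.distrib mult.assoc[symmetric])
  qed
  also have "(\<Prod>e\<in>edges G. R e) * tree_poly G (\<lambda>e. 1 / R e)
      = (\<Sum>T\<in>spanning_trees G. \<Prod>e\<in>edges G - T. R e)"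
    unfolding tree_poly_def sum_distrib_left
  proof (rule sum.cong[OF refl])
    fix T assume "T \<in> spanning_trees G"
    then have T: "T \<subseteq> edges G" by (auto simp: spanning_trees_def)
    have "(\<Prod>e\<in>T. R e) \<noteq> 0"
      using T fin Rpos by (auto simp: prod_zero_iff finite_subset less_imp_neq[symmetric] dest!: subsetD)
    moreover have "(\<Prod>e\<in>edges G. R e) = (\<Prod>e\<in>edges G - T. R e) * (\<Prod>e\<in>T. R e)"
      using T fin by (intro prod.subset_diff)
    ultimately show "(\<Prod>e\<in>edges G. R e) * (\<Prod>e\<in>T. 1 / R e) = (\<Prod>e\<in>edges G - T. R e)"
      by (simp add: prod_dividef)
  qed
  also have "(\<Prod>e\<in>edges G. \<Prod>i<Suc r. p e i)
      = (\<Prod>x\<in>edges ?H. \<Prod>y\<in>ends ?H x. real (vertex_degree ?H y))"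
    unfolding prodH by (intro prod.cong) (auto simp: ends_prod)
  also have "\<dots> = (\<Prod>x\<in>verts ?H. real (vertex_degree ?H x) ^ vertex_degree ?H x)"
    by (rule prod_edges_ends[OF wfH])
  \<comment> \<open>Each new vertex contributes \<open>2^2\<close> on both sides, once as pivot and
    once as \<open>D^D\<close>, so only the vertices of \<open>G\<close> remain.\<close>
  finally show ?thesis
    unfolding vertsH R_def
    by (simp add: vertex_degree_subdivision[OF wf] d_def)
qed

section \<open>Degrees 1 and \<open>k\<close>\<close>

text \<open>Integers are needed: a cycle, with \<open>k = 2\<close>, \<open>s = 0\<close> and
  \<open>m = n\<close>, gives \<open>k\<close> the exponent -1, and a single edge has
  \<open>s = 2\<close> and \<open>m = -1\<close>.\<close>

theorem corollary5p1:
  fixes G :: "('v, 'e) multigraph" and k n s r :: nat and m :: int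
  assumes "k \<ge> 2"
    and "wf_multigraph G"
    and "connected_graph G"
    and "card (verts G) = n + s"
    and "int (card (edges G)) = m + int s"
    and "card {v \<in> verts G. vertex_degree G v = 1} = s"
    and "\<forall>v\<in>verts G. vertex_degree G v \<noteq> 1 \<longrightarrow> vertex_degree G v = k"
  shows "real (num_spanning_trees (line_graph (subdivision r G)))
       = real k powi (m + int s - int n - 1) * real (r * k + 2) powi (m - int n + 1)
         * real (num_spanning_trees G)"
proof -
  let ?A = "{v \<in> verts G. vertex_degree G v = 1}" and ?B = "{v \<in> verts G. vertex_degree G v = k}"
  have k: "k \<ge> 2" and wf: "wf_multigraph G" by fact+
  have ne: "verts G \<noteq> {}"
    using assms(3) by (simp add: connected_graph_def)
  have fin: "finite (verts G)" "finite (edges G)"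
    using wf by (auto simp: wf_multigraph_def)
  have AB: "verts G = ?A \<union> ?B" "?A \<inter> ?B = {}"
    using assms(7) k by auto
  have "card (verts G) = card ?A + card ?B"
    using fin AB by (metis card_Un_disjoint finite_Un)
  then have cB: "card ?B = n"
    using assms(4,6) by simp
  \<comment> \<open>Vertices of degree 1 contribute 1 for any exponent. The parameter
    \<open>f\<close> covers both \<open>d^2\<close> and \<open>d^d\<close>.\<close>
  have prodV: "(\<Prod>v\<in>verts G. real (vertex_degree G v) ^ f (vertex_degree G v)) = real k ^ (f k * n)" for f
  proof -
    have "(\<Prod>v\<in>verts G. real (vertex_degree G v) ^ f (vertex_degree G v))
        = (\<Prod>v\<in>?A. real (vertex_degree G v) ^ f (vertex_degree G v))
          * (\<Prod>v\<in>?B. real (vertex_degree G v) ^ f (vertex_degree G v))"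
      using fin AB by (metis (no_types, lifting) finite_Un prod.union_disjoint)
    then show ?thesis by (simp add: cB power_mult)
  qed
  have handshake: "int k * int n = 2 * m + int s"
  proof -
    have "2 * card (edges G) = (\<Sum>v\<in>?A. vertex_degree G v) + (\<Sum>v\<in>?B. vertex_degree G v)"
      using fin AB sum_vertex_degree[OF wf] by (metis (no_types, lifting) finite_Un sum.union_disjoint)
    then have "2 * card (edges G) = s + k * n"
      using assms(6) cB by simp
    then have "2 * int (card (edges G)) = int s + int k * int n"
      by (metis of_nat_add of_nat_mult of_nat_numeral)
    then show ?thesis using assms(5) by simp
  qed
  \<comment> \<open>Edges outside a tree have both ends of degree \<open>k\<close>, so each has
    resistance \<open>r + 2 / k\<close>, and there are \<open>(m + s) - (n + s - 1)\<close> of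
    them.\<close>
  have cotree: "(\<Prod>e\<in>edges G - T. real r + (\<Sum>v\<in>ends G e. 1 / real (vertex_degree G v)))
      = (real (r * k + 2) / real k) powi (m - int n + 1)" if T: "T \<in> spanning_trees G" for T
  proof -
    obtain q where q: "q \<in> verts G" using ne by auto
    have sub: "T \<subseteq> edges G" using T by (simp add: spanning_trees_def)
    have "card T = card (verts G - {q})"
      using T spanning_trees_eq[OF wf q] by simp
    then have "Suc (card T) = n + s"
      using q fin assms(4) by (simp add: card_Suc_Diff1 del: card_Diff_insert)
    moreover have "card (edges G - T) + card T = card (edges G)"
      using sub fin card_mono[OF fin(2) sub] by (simp add: card_Diff_subset finite_subset)
    ultimately have "int (card (edges G - T)) = m - int n + 1"
      using assms(5) by linarith
    then have "(real (r * k + 2) / real k) ^ card (edges G - T)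
        = (real (r * k + 2) / real k) powi (m - int n + 1)"
      by (metis power_int_of_nat)
    moreover have "real r + (\<Sum>v\<in>ends G e. 1 / real (vertex_degree G v)) = real (r * k + 2) / real k"
      if e: "e \<in> edges G - T" for e
    proof -
      have ends: "ends G e \<subseteq> verts G" "card (ends G e) = 2"
        using e wf by (auto simp: wf_multigraph_def)
      have "vertex_degree G v = k" if v: "v \<in> ends G e" for v
      proof (rule ccontr)
        assume "vertex_degree G v \<noteq> k"
        with assms(7) v ends have "card {f \<in> edges G. v \<in> ends G f} = 1"
          by (auto simp: vertex_degree_def)
        then obtain g where "{f \<in> edges G. v \<in> ends G f} = {g}"
          by (auto simp: card_1_singleton_iff)
        moreover have "e \<in> {f \<in> edges G. v \<in> ends G f}"
          using e v by simp
        ultimately have only: "{f \<in> edges G. v \<in> ends G f} = {e}"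
          by simp
        have vV: "v \<in> verts G" using v ends by auto
        have "\<not> verts G \<subseteq> {v}"
        proof
          assume "verts G \<subseteq> {v}"
          with ends(1) have "ends G e \<subseteq> {v}" by blast
          from card_mono[OF _ this] ends(2) show False by simp
        qed
        then have "{v} \<subset> verts G"
          using vV by auto
        \<comment> \<open>With \<open>v\<close> as root, the cut \<open>{v}\<close> must be crossed
          by a tree edge; the only edge at \<open>v\<close> is \<open>e\<close>, which was assumed
          to lie outside \<open>T\<close>.\<close>
        moreover have "spans (verts G) (ends G) {v} T"
          using T spanning_trees_eq[OF wf vV] by simp
        ultimately have "\<exists>f\<in>T. ends G f \<inter> {v} \<noteq> {} \<and> \<not> ends G f \<subseteq> {v}"
          by (simp only: spans_def) (meson subset_refl)
        then obtain f where "f \<in> T" "v \<in> ends G f" by blast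
        with sub have "f \<in> {f \<in> edges G. v \<in> ends G f}" by blast
        with only have "f = e" by simp
        with \<open>f \<in> T\<close> e show False by simp
      qed
      then show ?thesis using ends k by (simp add: field_simps)
    qed
    then have "(\<Prod>e\<in>edges G - T. real r + (\<Sum>v\<in>ends G e. 1 / real (vertex_degree G v)))
        = (\<Prod>e\<in>edges G - T. real (r * k + 2) / real k)"
      by (rule prod.cong[OF refl])
    ultimately show ?thesis by simp
  qed
  have "real k ^ (2 * n) * real (num_spanning_trees (line_graph (subdivision r G)))
      = real k ^ (k * n) * ((real (r * k + 2) / real k) powi (m - int n + 1) * real (num_spanning_trees G))"
  proof -
    have "vertex_degree G v > 0" if "v \<in> verts G" for v
      using that assms(7) k by (cases "vertex_degree G v = 1") auto
    from num_spanning_trees_line_graph_subdivision[OF wf ne this, of r]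
    show ?thesis
      unfolding prodV[of "\<lambda>_. 2"] prodV[of "\<lambda>x. x"]
      by (simp add: cotree num_spanning_trees_def)
  qed
  moreover have "real k ^ (k * n) = real k powi (2 * int n) * real k powi (m + int s - int n - 1) * real k powi (m - int n + 1)"
  proof -
    \<comment> \<open>The exponent \<open>k n\<close> comes from \<open>d^d\<close>,
      \<open>2 n\<close> from \<open>d^2\<close> and \<open>m - n + 1\<close> from the denominators
      \<open>k\<close> of the resistances. By the handshake identity \<open>k n = 2 m + s\<close>,
      the remainder is \<open>m + s - n - 1\<close>.\<close>
    have *: "int (k * n) = 2 * int n + (m + int s - int n - 1) + (m - int n + 1)"
      using handshake by simp
    have "real k \<noteq> 0" using k by simp
    note add = power_int_add[OF disjI1[OF this]]
    show ?thesis
      unfolding power_int_of_nat[symmetric] * add ..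
  qed
  moreover have "real k ^ (2 * n) = real k powi (2 * int n)"
    by (metis of_nat_mult of_nat_numeral power_int_of_nat)
  ultimately show ?thesis
    using k by (simp add: power_int_divide_distrib)
qed

end
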